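(* Suppose: (i) the directed graph $\mathcal G$ is strongly connected and $W=[w_{ij}]\in\mathbb R^{n\times n}$ is a nonnegative doubly stochastic weight matrix for it ($W\mathbf 1_n=\mathbf 1_n$, $\mathbf 1_n^TW=\mathbf 1_n^T$, $w_{ii}>0$ for all $i$, and for $i\neq j$, $w_{ij}>0$ if agent $i$ can receive information from agent $j$ and $w_{ij}=0$ otherwise); (ii) there is $L_f>0$ with $\|\nabla F_i(X)-\nabla F_i(Y)\|\le L_f\|X-Y\|$ for all $X,Y\in\mathbb R^d$ and all $i\in\mathcal V$; (iii) the compressor $\mathcal C:\mathbb R^d\to\mathbb R^d$ satisfies, for some constants $r>0$ and $\psi\in(0,1]$, $\mathbf E_{\mathcal C}\big[\|\mathcal C(X)/r-X\|^2\big]\le(1-\psi)\|X\|^2$ for all $X\in\mathbb R^d$. Let every agent run Algorithm 1 (defined in the context) with $\varphi_X,\varphi_Y\in(0,\frac1r)$ and, with $c_1=\frac{\varphi_X\psi r}{2}$, $c_2=\frac{\varphi_Y\psi r}{2}$, $C=2r^2(1-\psi)+2(1-r)^2$, with $$\gamma\in\Big(0,\min\Big\{\tfrac{1-\sigma}{160(1+c_1^{-1})},\tfrac{1-\sigma}{40000(1+c_2^{-1})L_f^2},\tfrac{c_1(1-\sigma)}{40C},\tfrac{c_1}{8\sqrt C},\tfrac{c_1}{10L_f\sqrt{C(1+c_2^{-1})}},\tfrac{c_2L_f^2}{C},\tfrac{c_2}{10\sqrt C}\Big\}\Big),$$ $$\eta\in\Big(0,\min\Big\{\tfrac{(1-\sigma)^2\gamma}{40L_f},\tfrac{0.4(1-\sigma)\gamma}{L_f^2},\tfrac{(1-\sigma)^2}{80L_f}\sqrt{\tfrac{\gamma}{1+c_1^{-1}}},\tfrac{9}{40(4(1+c_1^{-1})+5(1+c_2^{-1}))},\tfrac1{2L_f},\gamma\Big\}\Big).$$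 Then for every $k\ge0$, $$\sum_{t=0}^{k}\mathbf E_{\mathcal C}\big[\|\boldsymbol X(t)-\bar{\boldsymbol X}(t)\|^2+n\|\nabla F(\bar X(t))\|^2\big]\le\frac{U(0)}{\theta_1}$$ and $$\mathbf E_{\mathcal C}\big[n(F(\bar X(k))-F^\star)\big]<U(0),$$ where $\theta_1=\min\{\theta_2,\theta_3\}$, $\theta_2=\frac\eta4-(\phi\varepsilon_1+\varepsilon_2+\varepsilon_3)$, $\theta_3=\min\{0.07(1-\sigma)\gamma,\ 0.44c_1(2c_1+1),\ 0.77c_2(2c_2+1)\}$, $\varepsilon_1=\frac{8L_f^2}{(1-\sigma)\gamma}\eta^2$, $\varepsilon_2=4(1+c_1^{-1})\eta^2$, $\varepsilon_3=5(1+c_2^{-1})\eta^2$.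
   Context: Problem. A group of $n$ agents $\mathcal V=\{1,\dots,n\}$ communicates over a directed graph $\mathcal G=(\mathcal V,\mathcal E)$. Agent $i$ has a differentiable (possibly nonconvex) cost $F_i:\mathbb R^d\to\mathbb R$; $F=\frac1n\sum_{i=1}^nF_i$; the set $\operatorname{argmin}F$ is nonempty and $F^\star=\min F>-\infty$. $\|\cdot\|$ is the Euclidean norm (spectral norm for matrices). $\sigma\in(0,1)$ denotes the spectral norm of $W-\frac1n\mathbf 1_n\mathbf 1_n^T$. Compressor. $\mathcal C$ is a possibly randomized map; $\mathbf E_{\mathcal C}$ is expectation over its internal randomness. Each application of $\mathcal C$ in the algorithm uses fresh randomness, independent of the past. Algorithm 1. Parameters $\gamma,\eta,\varphi_X,\varphi_Y>0$. Initialization for each $i\in\mathcal V$: $X_i(0)\in\mathbb R^d$ arbitrary, $Y_i(0)=\nabla F_i(X_i(0))$, $A_i(0)=B_i(0)=C_i(0)=D_i(0)=\mathbf 0_d$, $Q_i^X(0)=\mathcal C(X_i(0))$, $Q_i^Y(0)=\mathcal C(Y_i(0))$. For $k\ge0$ and each $i$: $A_i(k+1)=A_i(k)+\varphi_XQ_i^X(k)$; $B_i(k+1)=B_i(k)+\varphi_X\big(Q_i^X(k)-\sum_jw_{ij}Q_j^X(k)\big)$; $C_i(k+1)=C_i(k)+\varphi_YQ_i^Y(k)$; $D_i(k+1)=D_i(k)+\varphi_Y\big(Q_i^Y(k)-\sum_jw_{ij}Q_j^Y(k)\big)$; $X_i(k+1)=X_i(k)-\gamma\big[B_i(k)+Q_i^X(k)-\sum_jw_{ij}Q_j^X(k)\big]-\eta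 Y_i(k)$; $Y_i(k+1)=Y_i(k)-\gamma\big[D_i(k)+Q_i^Y(k)-\sum_jw_{ij}Q_j^Y(k)\big]+\nabla F_i(X_i(k+1))-\nabla F_i(X_i(k))$; $Q_i^X(k+1)=\mathcal C(X_i(k+1)-A_i(k+1))$; $Q_i^Y(k+1)=\mathcal C(Y_i(k+1)-C_i(k+1))$. Notation. $\boldsymbol X,\boldsymbol Y,\boldsymbol A,\boldsymbol C\in\mathbb R^{nd}$ are the stacked vectors of $X_i,Y_i,A_i,C_i$; $\bar X(k)=\frac1n\sum_iX_i(k)$; $\bar{\boldsymbol X}(k)=\mathbf 1_n\otimes\bar X(k)$; $\bar{\boldsymbol Y}(k)=\mathbf 1_n\otimes\frac1n\sum_iY_i(k)$. With $\phi=\frac{(1-\sigma)^2}{320L_f^2}$, $$V(k)=\|\boldsymbol X(k)-\bar{\boldsymbol X}(k)\|^2+\phi\|\boldsymbol Y(k)-\bar{\boldsymbol Y}(k)\|^2+\|\boldsymbol X(k)-\boldsymbol A(k)\|^2+\|\boldsymbol Y(k)-\boldsymbol C(k)\|^2,$$ $$U(k)=V(k)+n(F(\bar X(k))-F^\star).$$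
   Formalization: The strict bound E[n(F(X̄(k))−F* )] < U(0) is proved when V(0)>0, and with ≤ in general; if V(0)=0 (all X_i(0)=0 and ∇F_i(0)=0) the iterates stay at 0 and equality holds, so the strict inequality as printed fails there. *)

theory Defs
  imports "HOL-Probability.Probability" "Graph_Theory.Digraph_Component" "Graph_Theory.Pair_Digraph"
begin

definition gradient :: "('a::real_inner \<Rightarrow> real) \<Rightarrow> 'a \<Rightarrow> 'a" where
  "gradient f x = (THE g. GDERIV f x :> g)"

text \<open>An arc \<open>(j, i)\<close> of the communication graph means that agent \<open>i\<close> can receive information
  from agent \<open>j\<close>.\<close>

definition weight_matrix :: "'n::finite pair_pre_digraph \<Rightarrow> real^'n^'n \<Rightarrow> bool" where
  "weight_matrix G W \<longleftrightarrow>
     (\<forall>i j. 0 \<le> W $ i $ j) \<and> W *v 1 = 1 \<and> 1 v* W = 1 \<and> (\<forall>i. 0 < W $ i $ i) \<and>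
     (\<forall>i j. i \<noteq> j \<longrightarrow> (if (j, i) \<in> parcs G then 0 < W $ i $ j else W $ i $ j = 0))"

definition spectral_norm :: "real^'n^'m \<Rightarrow> real" where
  "spectral_norm A = onorm (\<lambda>v. A *v v)"

text \<open>Stacked vectors of \<open>n\<close> blocks in \<open>\<real>\<^sup>d\<close> have type \<open>real^'d^'n\<close>: \<open>X $ i\<close> is the block of agent
  \<open>i\<close>, and the norm of this type is the Euclidean norm of the stacked vector.\<close>

definition avg :: "real^'d^'n \<Rightarrow> real^'d" where
  "avg X = (1 / real CARD('n)) *\<^sub>R (\<Sum>i\<in>UNIV. X $ i)"

definition rep :: "real^'d \<Rightarrow> real^'d^'n" where
  "rep x = (\<chi> i. x)"

definition mix :: "real^'n^'n \<Rightarrow> real^'d^'n \<Rightarrow> real^'d^'n" where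
  "mix W Q = (\<chi> i. \<Sum>j\<in>UNIV. (W $ i $ j) *\<^sub>R (Q $ j))"

definition avg_cost :: "('n::finite \<Rightarrow> real^'d \<Rightarrow> real) \<Rightarrow> real^'d \<Rightarrow> real" where
  "avg_cost F x = (1 / real CARD('n)) * (\<Sum>i\<in>UNIV. F i x)"

definition grads :: "('n::finite \<Rightarrow> real^'d \<Rightarrow> real) \<Rightarrow> real^'d^'n \<Rightarrow> real^'d^'n" where
  "grads F X = (\<chi> i. gradient (F i) (X $ i))"

record ('d::finite, 'n::finite) alg_state =
  stX :: "real^'d^'n"
  stY :: "real^'d^'n"
  stA :: "real^'d^'n"
  stB :: "real^'d^'n"
  stC :: "real^'d^'n"
  stD :: "real^'d^'n"
  stQX :: "real^'d^'n"
  stQY :: "real^'d^'n"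

text \<open>In the following two definitions \<open>qX i\<close> and \<open>qY i\<close> are the realizations of the compressor
  that agent \<open>i\<close> uses to compute its new \<open>Q\<^sup>X\<close> and \<open>Q\<^sup>Y\<close>.\<close>

definition alg_init ::
  "('n::finite \<Rightarrow> real^'d::finite \<Rightarrow> real) \<Rightarrow> real^'d^'n \<Rightarrow>
   ('n \<Rightarrow> real^'d \<Rightarrow> real^'d) \<Rightarrow> ('n \<Rightarrow> real^'d \<Rightarrow> real^'d) \<Rightarrow> ('d, 'n) alg_state" where
  "alg_init F X0 qX qY =
     \<lparr> stX = X0, stY = grads F X0, stA = 0, stB = 0, stC = 0, stD = 0,
       stQX = (\<chi> i. qX i (X0 $ i)), stQY = (\<chi> i. qY i (grads F X0 $ i)) \<rparr>"

definition alg_step ::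
  "real^'n^'n \<Rightarrow> ('n::finite \<Rightarrow> real^'d::finite \<Rightarrow> real) \<Rightarrow> real \<Rightarrow> real \<Rightarrow> real \<Rightarrow> real \<Rightarrow>
   ('n \<Rightarrow> real^'d \<Rightarrow> real^'d) \<Rightarrow> ('n \<Rightarrow> real^'d \<Rightarrow> real^'d) \<Rightarrow>
   ('d, 'n) alg_state \<Rightarrow> ('d, 'n) alg_state" where
  "alg_step W F \<gamma> \<eta> \<phi>X \<phi>Y qX qY s =
     (let QX = stQX s; QY = stQY s;
          A' = stA s + \<phi>X *\<^sub>R QX;
          B' = stB s + \<phi>X *\<^sub>R (QX - mix W QX);
          C' = stC s + \<phi>Y *\<^sub>R QY;
          D' = stD s + \<phi>Y *\<^sub>R (QY - mix W QY);
          X' = stX s - \<gamma> *\<^sub>R (stB s + QX - mix W QX) - \<eta> *\<^sub>R stY s;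
          Y' = stY s - \<gamma> *\<^sub>R (stD s + QY - mix W QY) + grads F X' - grads F (stX s)
      in \<lparr> stX = X', stY = Y', stA = A', stB = B', stC = C', stD = D',
           stQX = (\<chi> i. qX i (X' $ i - A' $ i)), stQY = (\<chi> i. qY i (Y' $ i - C' $ i)) \<rparr>)"

text \<open>A randomized compressor is a map \<open>compr\<close> taking a random seed as additional argument. Every
  application of the compressor reads its own seed: \<open>seed c k i\<close> is the one used by agent \<open>i\<close> for
  \<open>Q\<^sub>i\<^sup>X(k)\<close> (\<open>c = ChanX\<close>) or \<open>Q\<^sub>i\<^sup>Y(k)\<close> (\<open>c = ChanY\<close>).\<close>

datatype channel = ChanX | ChanY

primrec algorithm ::
  "real^'n^'n \<Rightarrow> ('n::finite \<Rightarrow> real^'d::finite \<Rightarrow> real) \<Rightarrow> real \<Rightarrow> real \<Rightarrow> real \<Rightarrow> real \<Rightarrow>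
   ('r \<Rightarrow> real^'d \<Rightarrow> real^'d) \<Rightarrow> real^'d^'n \<Rightarrow> (channel \<Rightarrow> nat \<Rightarrow> 'n \<Rightarrow> 'r) \<Rightarrow>
   nat \<Rightarrow> ('d, 'n) alg_state" where
  "algorithm W F \<gamma> \<eta> \<phi>X \<phi>Y compr X0 seed 0 =
     alg_init F X0 (\<lambda>i. compr (seed ChanX 0 i)) (\<lambda>i. compr (seed ChanY 0 i))"
| "algorithm W F \<gamma> \<eta> \<phi>X \<phi>Y compr X0 seed (Suc k) =
     alg_step W F \<gamma> \<eta> \<phi>X \<phi>Y
       (\<lambda>i. compr (seed ChanX (Suc k) i)) (\<lambda>i. compr (seed ChanY (Suc k) i))
       (algorithm W F \<gamma> \<eta> \<phi>X \<phi>Y compr X0 seed k)"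

definition lyapunov_V ::
  "real \<Rightarrow> real^'d^'n \<Rightarrow> real^'d^'n \<Rightarrow> real^'d^'n \<Rightarrow> real^'d^'n \<Rightarrow> real" where
  "lyapunov_V \<phi> X Y A C =
     (norm (X - rep (avg X)))\<^sup>2 + \<phi> * (norm (Y - rep (avg Y)))\<^sup>2 + (norm (X - A))\<^sup>2 + (norm (Y - C))\<^sup>2"

definition lyapunov_U ::
  "('n::finite \<Rightarrow> real^'d \<Rightarrow> real) \<Rightarrow> real \<Rightarrow>
   real \<Rightarrow> real^'d^'n \<Rightarrow> real^'d^'n \<Rightarrow> real^'d^'n \<Rightarrow> real^'d^'n \<Rightarrow> real" where
  "lyapunov_U F Fstar \<phi> X Y A C =
     lyapunov_V \<phi> X Y A C + real CARD('n) * (avg_cost F (avg X) - Fstar)"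

text \<open>The step size bounds are taken in the extended reals because the constant \<open>C\<close> of the compressor
  vanishes for \<open>r = \<psi> = 1\<close> (no compression). The bounds having \<open>C\<close> in the denominator then equal
  \<open>\<infinity>\<close>, whereas real division by zero would make them \<open>0\<close> and exclude this case.\<close>

definition gamma_max :: "real \<Rightarrow> real \<Rightarrow> real \<Rightarrow> real \<Rightarrow> real \<Rightarrow> ereal" where
  "gamma_max \<sigma> L c1 c2 C = Min
     { ereal ((1 - \<sigma>) / (160 * (1 + 1 / c1))),
       ereal ((1 - \<sigma>) / (40000 * (1 + 1 / c2) * L\<^sup>2)),
       ereal (c1 * (1 - \<sigma>)) / ereal (40 * C),
       ereal c1 / ereal (8 * sqrt C),
       ereal c1 / ereal (10 * L * sqrt (C * (1 + 1 / c2))),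
       ereal (c2 * L\<^sup>2) / ereal C,
       ereal c2 / ereal (10 * sqrt C) }"

definition eta_max :: "real \<Rightarrow> real \<Rightarrow> real \<Rightarrow> real \<Rightarrow> real \<Rightarrow> real" where
  "eta_max \<sigma> L c1 c2 \<gamma> = Min
     { (1 - \<sigma>)\<^sup>2 * \<gamma> / (40 * L),
       0.4 * (1 - \<sigma>) * \<gamma> / L\<^sup>2,
       (1 - \<sigma>)\<^sup>2 / (80 * L) * sqrt (\<gamma> / (1 + 1 / c1)),
       9 / (40 * (4 * (1 + 1 / c1) + 5 * (1 + 1 / c2))),
       1 / (2 * L),
       \<gamma> }"

end

theory Submission
  imports Defs
begin

text \<open>With \<open>N = I - W\<close>, the algorithm reads \<open>X' = X - \<gamma> N (A + Q\<^sup>X) - \<eta> Y\<close>, and likewise for \<open>Y\<close>, because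
  \<open>B = N A\<close> is invariant. So gradient tracking is perturbed only by the compression error of \<open>X - A\<close>,
  whose mean square contracts up to the displacement \<open>X' - X\<close>. For the deviation \<open>x\<close> of \<open>X\<close>
  from its average, the mixing step dissipates \<open>x \<bullet> N x\<close>, which dominates both
  \<open>(1 - \<sigma>) \<parallel>x\<parallel>\<^sup>2\<close> and \<open>\<parallel>N x\<parallel>\<^sup>2 / 2\<close>. Absorbing all errors into these dissipations and into the descent of
  the cost makes a potential, obtained from \<open>U\<close> by lowering one weight, decrease in expectation, and
  summation over time gives the claim.\<close>

section \<open>Gradients, averages and mixing\<close>

text \<open>Randomness is kept out of the inequalities: each step yields an estimate valid for every
  outcome, in which the compressor enters only through \<open>compression_excess\<close>, with a
  nonnegative weight. This avoids conditional expectations. A single integration remains, and since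
  the seed read at time \<open>k\<close> is independent of \<open>X(k) - A(k)\<close> and
  \<open>Y(k) - C(k)\<close>, which depend on earlier seeds only, Fubini reduces it to the
  compressor hypothesis at a frozen vector. The same pointwise estimate also supplies integrability
  for the next time step. The decrease is stronger than what \<open>\<theta>1\<close> asks for:
  disagreement is dissipated at rate \<open>0.9 * \<gamma> * (1 - \<sigma>)\<close> and the squared
  gradient at rate \<open>\<eta> / 2\<close>. Both are at least \<open>\<theta>1\<close>, so what
  remains for \<open>\<theta>1\<close> is its positivity and these two comparisons.\<close>

lemma GDERIV_gradient:
  fixes f :: "'a::euclidean_space \<Rightarrow> real"
  assumes "f differentiable at x"
  shows "GDERIV f x :> gradient f x"
proof -
  obtain f' where f': "(f has_derivative f') (at x)"
    using assms by (auto simp: differentiable_def)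
  interpret bounded_linear f'
    using f' by (rule has_derivative_bounded_linear)
  \<comment> \<open>The coordinates of the derivative in the standard basis give its Riesz
    representer. Together with the uniqueness shown below, the definite description in
    \<open>gradient\<close> denotes it.\<close>
  have "f' = (\<lambda>h. h \<bullet> (\<Sum>b\<in>Basis. f' b *\<^sub>R b))"
  proof
    fix h
    have "f' h = f' (\<Sum>b\<in>Basis. (h \<bullet> b) *\<^sub>R b)"
      by (simp add: euclidean_representation)
    also have "\<dots> = h \<bullet> (\<Sum>b\<in>Basis. f' b *\<^sub>R b)"
      by (simp add: sum scaleR inner_sum_right mult.commute)
    finally show "f' h = h \<bullet> (\<Sum>b\<in>Basis. f' b *\<^sub>R b)" .
  qed
  then have ex: "GDERIV f x :> (\<Sum>b\<in>Basis. f' b *\<^sub>R b)"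
    using f' unfolding gderiv_def by simp
  have "g = g'" if "GDERIV f x :> g" "GDERIV f x :> g'" for g g'
  proof -
    have "(\<lambda>h. h \<bullet> g) = (\<lambda>h. h \<bullet> g')"
      using that unfolding gderiv_def by (rule has_derivative_unique)
    then show ?thesis by (metis inner_commute vector_eq_rdot)
  qed
  with ex show ?thesis
    unfolding gradient_def by (metis theI)
qed

lemma gradient_eqI:
  fixes f :: "'a::euclidean_space \<Rightarrow> real"
  assumes "GDERIV f x :> g"
  shows "gradient f x = g"
proof -
  have "f differentiable at x"
    using assms unfolding gderiv_def by (rule differentiableI)
  then have "(\<lambda>h. h \<bullet> gradient f x) = (\<lambda>h. h \<bullet> g)"
    using GDERIV_gradient assms unfolding gderiv_def by (blast intro: has_derivative_unique)
  then show ?thesis by (metis inner_commute vector_eq_rdot)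
qed

text \<open>Along the segment from \<open>x\<close> to \<open>x + h\<close>, subtracting the linear
  and quadratic terms from \<open>f\<close> leaves a function \<open>p\<close> whose derivative is
  nonpositive, by Cauchy-Schwarz and the Lipschitz bound. The claim is
  \<open>p 1 \<le> p 0\<close>.\<close>

lemma descent_lemma:
  fixes f :: "'a::euclidean_space \<Rightarrow> real"
  assumes diff: "\<And>x. GDERIV f x :> g x"
    and lip: "\<And>x y. norm (g x - g y) \<le> L * norm (x - y)"
  shows "f (x + h) \<le> f x + g x \<bullet> h + L / 2 * (norm h)\<^sup>2"
proof -
  define p where "p t = f (x + t *\<^sub>R h) - t * (g x \<bullet> h) - L / 2 * t\<^sup>2 * (norm h)\<^sup>2" for t
  define p' where "p' t = (g (x + t *\<^sub>R h) - g x) \<bullet> h - L * t * (norm h)\<^sup>2" for t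
  have "(p has_real_derivative p' t) (at t)" for t
  proof -
    have "((\<lambda>t. f (x + t *\<^sub>R h)) has_derivative (\<lambda>s. (s *\<^sub>R h) \<bullet> g (x + t *\<^sub>R h))) (at t)"
      by (rule has_derivative_compose[where g = f])
        (use diff in \<open>auto simp: gderiv_def intro!: derivative_eq_intros\<close>)
    then have "((\<lambda>t. f (x + t *\<^sub>R h)) has_real_derivative g (x + t *\<^sub>R h) \<bullet> h) (at t)"
      by (simp add: has_field_derivative_def inner_commute mult_commute_abs)
    from this show ?thesis
      unfolding p_def p'_def
      by (auto intro!: derivative_eq_intros simp: inner_diff_left)
  qed
  moreover have "p' t \<le> 0" if "0 \<le> t" for t
  proof -
    have "(g (x + t *\<^sub>R h) - g x) \<bullet> h \<le> norm (g (x + t *\<^sub>R h) - g x) * norm h"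
      by (rule norm_cauchy_schwarz)
    also have "\<dots> \<le> (L * norm (t *\<^sub>R h)) * norm h"
      using lip[of "x + t *\<^sub>R h" x] by (intro mult_right_mono) auto
    finally show ?thesis
      using that by (simp add: p'_def power2_eq_square mult_ac)
  qed
  ultimately have "p 1 \<le> p 0"
    by (intro DERIV_nonpos_imp_nonincreasing[of 0 1 p]) auto
  then show ?thesis by (simp add: p_def)
qed

lemma GDERIV_avg_cost:
  fixes F :: "'n::finite \<Rightarrow> real^'d::finite \<Rightarrow> real"
  assumes "\<And>i. F i differentiable at x"
  shows "GDERIV (avg_cost F) x :> avg (\<chi> i. gradient (F i) x)"
proof -
  have "((\<lambda>x. \<Sum>i\<in>UNIV. F i x) has_derivative (\<lambda>h. \<Sum>i\<in>UNIV. h \<bullet> gradient (F i) x)) (at x)"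
    using GDERIV_gradient[OF assms] unfolding gderiv_def by (intro has_derivative_sum)
  from has_derivative_mult_right[OF this, of "1 / real CARD('n)"] show ?thesis
    unfolding gderiv_def avg_cost_def[abs_def] avg_def
    by (simp add: inner_sum_right)
qed

section \<open>Stacked vectors: averages, consensus and mixing\<close>

lemma norm_vec_power2:
  fixes x :: "'a::real_inner^'n::finite"
  shows "(norm x)\<^sup>2 = (\<Sum>i\<in>UNIV. (norm (x $ i))\<^sup>2)"
  by (simp add: power2_norm_eq_inner inner_vec_def)

lemma avg_simps [simp]:
  fixes X Y :: "real^'d^'n::finite"
  shows "avg (X + Y) = avg X + avg Y" "avg (X - Y) = avg X - avg Y" "avg (a *\<^sub>R X) = a *\<^sub>R avg X"
    "avg (0 :: real^'d^'n) = 0" "avg (rep x :: real^'d^'n) = x" "avg (- X) = - avg X"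
  by (simp_all add: avg_def rep_def sum.distrib sum_subtractf scaleR_add_right
      scaleR_diff_right sum_constant_scaleR sum_negf del: sum_constant flip: scaleR_sum_right)

lemma rep_simps [simp]:
  shows "rep (x + y) = rep x + rep y" "rep (x - y) = rep x - rep y" "rep (a *\<^sub>R x) = a *\<^sub>R rep x" "rep (- x) = - rep x"
  by (simp_all add: rep_def vec_eq_iff)

lemma mix_simps:
  fixes X Y :: "real^'d^'n::finite"
  shows "mix W (X + Y) = mix W X + mix W Y" "mix W (X - Y) = mix W X - mix W Y"
    "mix W (a *\<^sub>R X) = a *\<^sub>R mix W X" "mix W (0 :: real^'d^'n) = 0"
proof -
  show "mix W (X + Y) = mix W X + mix W Y" "mix W (X - Y) = mix W X - mix W Y"
    "mix W (0 :: real^'d^'n) = 0"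
    by (simp_all add: mix_def vec_eq_iff[where 'b='n] sum.distrib sum_subtractf scaleR_add_right scaleR_diff_right)
  show "mix W (a *\<^sub>R X) = a *\<^sub>R mix W X"
    unfolding mix_def by (simp add: vec_eq_iff[where 'b='n] scaleR_sum_right mult.commute)
qed

lemma inner_rep:
  fixes X :: "real^'d::finite^'n::finite"
  shows "rep a \<bullet> X = real CARD('n) * (a \<bullet> avg X)"
  by (simp add: inner_vec_def[where 'b='n] rep_def avg_def inner_sum_right)

lemma norm_rep_power2: "(norm (rep a :: real^'d::finite^'n::finite))\<^sup>2 = real CARD('n) * (norm a)\<^sup>2"
  by (simp add: power2_norm_eq_inner inner_rep)

lemma norm_decomp:
  fixes X :: "real^'d::finite^'n::finite"
  shows "(norm X)\<^sup>2 = (norm (X - rep (avg X)))\<^sup>2 + (norm (rep (avg X) :: real^'d^'n))\<^sup>2"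
proof -
  have "rep (avg X) \<bullet> (X - rep (avg X)) = 0"
    by (simp add: inner_rep)
  then have "(norm (rep (avg X) + (X - rep (avg X))))\<^sup>2 = (norm (rep (avg X) :: real^'d^'n))\<^sup>2 + (norm (X - rep (avg X)))\<^sup>2"
    by (intro norm_add_Pythagorean) (simp add: orthogonal_def)
  then show ?thesis by simp
qed

lemma norm_deviation_le:
  fixes X :: "real^'d::finite^'n::finite"
  shows "norm (X - rep (avg X)) \<le> norm X"
  by (rule power2_le_imp_le) (simp_all add: norm_decomp[of X])

lemma inner_mix:
  fixes X Y :: "real^'d::finite^'n::finite"
  shows "X \<bullet> mix W Y = mix (transpose W) X \<bullet> Y"
proof -
  have "X \<bullet> mix W Y = (\<Sum>i\<in>UNIV. \<Sum>j\<in>UNIV. W $ i $ j * (X $ i \<bullet> Y $ j))"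
    by (simp add: inner_vec_def[where 'b='n] mix_def inner_sum_right)
  also have "\<dots> = mix (transpose W) X \<bullet> Y"
    by (subst sum.swap) (simp add: inner_vec_def[where 'b='n] mix_def inner_sum_left transpose_def)
  finally show ?thesis .
qed

lemma weight_matrix_sums:
  assumes "weight_matrix G W"
  shows "(\<Sum>j\<in>UNIV. W $ i $ j) = 1" "(\<Sum>j\<in>UNIV. W $ j $ i) = 1"
proof -
  have "(W *v 1) $ i = 1" "(1 v* W) $ i = 1"
    using assms by (simp_all add: weight_matrix_def)
  then show "(\<Sum>j\<in>UNIV. W $ i $ j) = 1" "(\<Sum>j\<in>UNIV. W $ j $ i) = 1"
    by (simp_all add: matrix_vector_mult_def vector_matrix_mult_def)
qed

lemma mix_rep:
  assumes "\<And>i. (\<Sum>j\<in>UNIV. W $ i $ j) = 1"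
  shows "mix W (rep a) = rep a"
  using assms by (simp add: mix_def rep_def vec_eq_iff flip: sum_distrib_right)

lemma avg_mix:
  assumes "\<And>j. (\<Sum>i\<in>UNIV. W $ i $ j) = 1"
  shows "avg (mix W X) = avg X"
proof -
  have "(\<Sum>i\<in>UNIV. \<Sum>j\<in>UNIV. W $ i $ j *\<^sub>R X $ j) = (\<Sum>j\<in>UNIV. X $ j)"
    by (subst sum.swap) (simp add: assms flip: scaleR_sum_left)
  then show ?thesis by (simp add: avg_def mix_def)
qed

text \<open>The spectral norm concerns vectors with one real entry per agent, whereas stacked
  vectors have blocks in \<open>real^'d\<close>. Mixing acts separately on each of the block
  coordinates, collected over all agents in \<open>v l\<close>. The constant matrix annihilates
  every such column because the average is 0, and the squared column bounds add up.\<close>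

lemma norm_mix_le:
  fixes X :: "real^'d::finite^'n::finite"
  assumes "avg X = 0"
  shows "norm (mix W X) \<le> spectral_norm (W - (\<chi> i j. c)) * norm X"
proof -
  define A where "A = W - (\<chi> i j. c)"
  define v where "v l = (\<chi> i. X $ i $ l)" for l
  have sumX: "(\<Sum>j\<in>UNIV. X $ j) = 0"
    using assms by (simp add: avg_def)
  have bl: "bounded_linear ((*v) A)"
    by (rule matrix_vector_mul_bounded_linear)
  have norm_cols: "(norm Z)\<^sup>2 = (\<Sum>l\<in>UNIV. (norm (\<chi> i. Z $ i $ l))\<^sup>2)" for Z :: "real^'d^'n"
    unfolding norm_vec_power2[where 'n='n] norm_vec_power2[where 'n='d]
    by (subst sum.swap) simp
  have col: "(\<chi> i. mix W X $ i $ l) = A *v v l" for l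
  proof (rule vec_eq_iff[THEN iffD2], rule allI)
    fix i
    have "(A *v v l) $ i = (\<Sum>j\<in>UNIV. W $ i $ j * X $ j $ l) - c * (\<Sum>j\<in>UNIV. X $ j) $ l"
      by (simp add: A_def v_def matrix_vector_mult_def left_diff_distrib sum_subtractf sum_distrib_left)
    then show "(\<chi> i. mix W X $ i $ l) $ i = (A *v v l) $ i"
      using sumX by (simp add: mix_def)
  qed
  have "(norm (mix W X))\<^sup>2 = (\<Sum>l\<in>UNIV. (norm (A *v v l))\<^sup>2)"
    by (simp add: norm_cols[of "mix W X"] col)
  also have "\<dots> \<le> (\<Sum>l\<in>UNIV. (spectral_norm A * norm (v l))\<^sup>2)"
    unfolding spectral_norm_def by (intro sum_mono power_mono onorm[OF bl]) simp
  also have "\<dots> = (spectral_norm A * norm X)\<^sup>2"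
    by (simp add: power_mult_distrib norm_cols[of X] v_def flip: sum_distrib_left)
  finally show ?thesis
    unfolding A_def spectral_norm_def
    by (rule power2_le_imp_le) (simp add: onorm_pos_le matrix_vector_mul_bounded_linear)
qed

text \<open>With \<open>?T\<close> the transposed mixing of \<open>X\<close>, the squared norm of
  \<open>?T\<close> is the inner product of \<open>X\<close> with \<open>mix W ?T\<close>. As the
  rows of \<open>W\<close> sum to 1, \<open>?T\<close> again has average 0, so the bound for
  \<open>W\<close> applies to it and one factor \<open>norm ?T\<close> cancels.\<close>

lemma norm_mix_transpose_le:
  fixes X :: "real^'d::finite^'n::finite"
  assumes col: "\<And>j. (\<Sum>i\<in>UNIV. W $ i $ j) = 1" and row: "\<And>i. (\<Sum>j\<in>UNIV. W $ i $ j) = 1"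
    and X: "avg X = 0"
  shows "norm (mix (transpose W) X) \<le> spectral_norm (W - (\<chi> i j. c)) * norm X"
proof -
  let ?T = "mix (transpose W) X" and ?s = "spectral_norm (W - (\<chi> i j. c))"
  have "avg ?T = 0"
    using row X by (subst avg_mix) (simp_all add: transpose_def)
  have "(norm ?T)\<^sup>2 = X \<bullet> mix W ?T"
    by (simp add: inner_mix power2_norm_eq_inner)
  also have "\<dots> \<le> norm X * norm (mix W ?T)"
    by (rule norm_cauchy_schwarz)
  also have "\<dots> \<le> norm X * (?s * norm ?T)"
    by (intro mult_left_mono norm_mix_le \<open>avg ?T = 0\<close>) simp
  finally have "norm ?T * norm ?T \<le> (?s * norm X) * norm ?T"
    by (simp add: power2_eq_square mult_ac)
  moreover have "0 \<le> ?s"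
    by (simp add: spectral_norm_def onorm_pos_le matrix_vector_mul_bounded_linear)
  ultimately show ?thesis
    by (cases "norm ?T = 0") (auto simp: mult_le_cancel_right)
qed

text \<open>Bounding \<open>\<parallel>X - W X\<parallel>\<^sup>2\<close> by twice the dissipation instead of \<open>4 \<parallel>X\<parallel>\<^sup>2\<close> saves a factor
  \<open>1 - \<sigma>\<close> in the step size conditions.\<close>

lemma laplacian_bounds:
  fixes X E :: "real^'d::finite^'n::finite"
  assumes col: "\<And>j. (\<Sum>i\<in>UNIV. W $ i $ j) = 1" and row: "\<And>i. (\<Sum>j\<in>UNIV. W $ i $ j) = 1"
    and sigma: "\<sigma> = spectral_norm (W - (\<chi> i j. c))" "0 \<le> \<sigma>" "\<sigma> \<le> 1"
    and X: "avg X = 0"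
  shows "(1 - \<sigma>) * (norm X)\<^sup>2 \<le> X \<bullet> (X - mix W X)"
    and "(norm (X - mix W X))\<^sup>2 \<le> 2 * (X \<bullet> (X - mix W X))"
    and "2 * (X \<bullet> (E - mix W E)) \<le> X \<bullet> (X - mix W X) / 4 + 8 * (norm E)\<^sup>2"
    and "(norm (E - mix W E))\<^sup>2 \<le> 4 * (norm E)\<^sup>2"
proof -
  have WX: "norm (mix W X) \<le> \<sigma> * norm X" and TX: "norm (mix (transpose W) X) \<le> \<sigma> * norm X"
    using norm_mix_le[OF X] norm_mix_transpose_le[OF col row X] by (simp_all add: sigma)
  have sq: "(norm V)\<^sup>2 \<le> (norm X)\<^sup>2" if "norm V \<le> \<sigma> * norm X" for V :: "real^'d^'n"
  proof -
    have "\<sigma> * norm X \<le> norm X" using sigma(3) by (simp add: mult_left_le_one_le sigma(2))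
    with that show ?thesis by (intro power_mono) auto
  qed
  have "X \<bullet> mix W X \<le> norm X * (\<sigma> * norm X)"
    using norm_cauchy_schwarz[of X "mix W X"] WX by (meson mult_left_mono norm_ge_zero order_trans)
  then show "(1 - \<sigma>) * (norm X)\<^sup>2 \<le> X \<bullet> (X - mix W X)"
    by (simp add: inner_diff_right power2_norm_eq_inner[symmetric] algebra_simps power2_eq_square)
  have expand: "(norm (X - V))\<^sup>2 \<le> 2 * (X \<bullet> (X - V))" if "(norm V)\<^sup>2 \<le> (norm X)\<^sup>2" for V
    using that by (simp add: power2_norm_eq_inner inner_diff_left inner_diff_right inner_commute)
  show "(norm (X - mix W X))\<^sup>2 \<le> 2 * (X \<bullet> (X - mix W X))"
    by (rule expand[OF sq[OF WX]])
  \<comment> \<open>\<open>W\<close> may be asymmetric, so moving the mixing from \<open>E\<close>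
    to \<open>X\<close> produces the transpose. Its quadratic form at \<open>X\<close> is the same
    as that of \<open>W\<close>, hence the same dissipation controls it.\<close>
  have T: "(norm (X - mix (transpose W) X))\<^sup>2 \<le> 2 * (X \<bullet> (X - mix W X))"
    using expand[OF sq[OF TX]] inner_mix[of X W X] inner_commute[of X "mix (transpose W) X"]
    by (simp add: inner_diff_right)
  have "X \<bullet> (E - mix W E) = (X - mix (transpose W) X) \<bullet> E"
    by (simp add: inner_diff_right inner_diff_left inner_mix)
  also have "\<dots> \<le> norm (X - mix (transpose W) X) * norm E"
    by (rule norm_cauchy_schwarz)
  finally have 1: "X \<bullet> (E - mix W E) \<le> norm (X - mix (transpose W) X) * norm E" .
  \<comment> \<open>The weight \<open>sqrt 8\<close> turns the factor 2 in \<open>T\<close> into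
    exactly a quarter of the dissipation.\<close>
  have "0 \<le> (norm (X - mix (transpose W) X) / sqrt 8 - sqrt 8 * norm E)\<^sup>2"
    by simp
  then have "2 * (norm (X - mix (transpose W) X) * norm E)
      \<le> (norm (X - mix (transpose W) X))\<^sup>2 / 8 + 8 * (norm E)\<^sup>2"
    by (simp add: power2_diff power_divide power_mult_distrib)
  with 1 T show "2 * (X \<bullet> (E - mix W E)) \<le> X \<bullet> (X - mix W X) / 4 + 8 * (norm E)\<^sup>2"
    by linarith
  \<comment> \<open>\<open>E\<close> may have a nonzero average, but a consensus vector is fixed by
    mixing and drops out of \<open>E - mix W E\<close>.\<close>
  define E' where "E' = E - rep (avg E)"
  have E': "avg E' = 0" "E - mix W E = E' - mix W E'" "norm E' \<le> norm E"
    by (simp_all add: E'_def mix_simps mix_rep[OF row] norm_deviation_le)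
  have "norm (mix W E') \<le> 1 * norm E'"
    using norm_mix_le[OF E'(1), of W c] sigma(3) unfolding sigma(1)
    by (meson mult_right_mono norm_ge_zero order_trans)
  then have "norm (E - mix W E) \<le> 2 * norm E"
    using E' norm_triangle_ineq4[of E' "mix W E'"] by simp
  then have "(norm (E - mix W E))\<^sup>2 \<le> (2 * norm E)\<^sup>2"
    by (intro power_mono) auto
  then show "(norm (E - mix W E))\<^sup>2 \<le> 4 * (norm E)\<^sup>2"
    by (simp add: power_mult_distrib)
qed

section \<open>One step of mixing and of compression\<close>

lemma power2_norm_add_le:
  fixes x y :: "'a::real_inner"
  assumes "0 < t"
  shows "(norm (x + y))\<^sup>2 \<le> (1 + t) * (norm x)\<^sup>2 + (1 + 1 / t) * (norm y)\<^sup>2"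
    and "2 * (x \<bullet> y) \<le> t * (norm x)\<^sup>2 + (1 / t) * (norm y)\<^sup>2"
proof -
  have "0 \<le> (norm (t *\<^sub>R x - y))\<^sup>2 / t"
    using assms by simp
  also have "(norm (t *\<^sub>R x - y))\<^sup>2 = t\<^sup>2 * (norm x)\<^sup>2 - 2 * t * (x \<bullet> y) + (norm y)\<^sup>2"
    unfolding power2_norm_eq_inner
    by (simp add: inner_diff_left inner_diff_right inner_commute power2_eq_square)
  also have "\<dots> / t = t * (norm x)\<^sup>2 - 2 * (x \<bullet> y) + (1 / t) * (norm y)\<^sup>2"
    using assms by (simp add: field_simps power2_eq_square)
  finally show *: "2 * (x \<bullet> y) \<le> t * (norm x)\<^sup>2 + (1 / t) * (norm y)\<^sup>2"
    by linarith
  have "(norm (x + y))\<^sup>2 = (norm x)\<^sup>2 + 2 * (x \<bullet> y) + (norm y)\<^sup>2"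
    by (simp add: power2_norm_eq_inner inner_add_left inner_add_right inner_commute)
  with * show "(norm (x + y))\<^sup>2 \<le> (1 + t) * (norm x)\<^sup>2 + (1 + 1 / t) * (norm y)\<^sup>2"
    by (simp add: algebra_simps)
qed

lemma power2_norm_add3_le:
  fixes x y z :: "'a::real_inner"
  shows "(norm (x + y + z))\<^sup>2 \<le> 3 * ((norm x)\<^sup>2 + (norm y)\<^sup>2 + (norm z)\<^sup>2)"
  using power2_norm_add_le(1)[of 1 x y] power2_norm_add_le(1)[of "1/2" "x + y" z] by (simp add: algebra_simps)

text \<open>Here \<open>u\<close> is the Laplacian of the deviation \<open>x\<close>,
  \<open>v\<close> that of the compression error \<open>e\<close>, and \<open>p\<close> a
  perturbation. From the dissipation \<open>2 * \<gamma> * (x \<bullet> u)\<close>, the cross term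
  with \<open>v\<close> takes 1/4, the one with \<open>p\<close> takes 1/2 (Young with weight
  \<open>\<gamma> * q / 2\<close>), and the second order terms take 6/480, in units of
  \<open>\<gamma> * (x \<bullet> u)\<close>; at least 1.2 is left. Likewise 8 + 12/480 < 8.1, and
  the 3 in front of the squared norm of \<open>p\<close> is below
  \<open>0.1 / (\<gamma> * q)\<close>.\<close>

lemma contraction_step:
  fixes x e p u v :: "'a::real_inner"
  assumes "q * (norm x)\<^sup>2 \<le> x \<bullet> u" "(norm u)\<^sup>2 \<le> 2 * (x \<bullet> u)"
    and "2 * (x \<bullet> v) \<le> (x \<bullet> u) / 4 + 8 * (norm e)\<^sup>2" "(norm v)\<^sup>2 \<le> 4 * (norm e)\<^sup>2"
    and q: "0 < q" "q \<le> 1" and g: "0 < \<gamma>" "\<gamma> \<le> 1 / 480"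
  shows "(norm (x - \<gamma> *\<^sub>R u + \<gamma> *\<^sub>R v + p))\<^sup>2
      \<le> (norm x)\<^sup>2 - 1.2 * \<gamma> * (x \<bullet> u) + 8.1 * \<gamma> * (norm e)\<^sup>2 + 2.1 / (\<gamma> * q) * (norm p)\<^sup>2" (is ?thesis1)
    and "(norm (- \<gamma> *\<^sub>R u + \<gamma> *\<^sub>R v + p))\<^sup>2
      \<le> 6 * \<gamma>\<^sup>2 * (x \<bullet> u) + 12 * \<gamma>\<^sup>2 * (norm e)\<^sup>2 + 3 * (norm p)\<^sup>2" (is ?thesis2)
proof -
  define w where "w = - \<gamma> *\<^sub>R u + \<gamma> *\<^sub>R v + p"
  define D where "D = x \<bullet> u"
  have D: "q * (norm x)\<^sup>2 \<le> D" "(norm u)\<^sup>2 \<le> 2 * D" "2 * (x \<bullet> v) \<le> D / 4 + 8 * (norm e)\<^sup>2" "0 \<le> D"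
    using assms(1-3) q by (auto simp: D_def intro: order_trans[rotated])
  have "(norm w)\<^sup>2 \<le> 3 * (\<gamma>\<^sup>2 * (norm u)\<^sup>2 + \<gamma>\<^sup>2 * (norm v)\<^sup>2 + (norm p)\<^sup>2)"
    unfolding w_def using power2_norm_add3_le[of "- \<gamma> *\<^sub>R u" "\<gamma> *\<^sub>R v" p]
    by (simp add: power_mult_distrib)
  moreover have "\<gamma>\<^sup>2 * (norm u)\<^sup>2 \<le> \<gamma>\<^sup>2 * (2 * D)" "\<gamma>\<^sup>2 * (norm v)\<^sup>2 \<le> \<gamma>\<^sup>2 * (4 * (norm e)\<^sup>2)"
    using D assms(4) by (auto intro!: mult_left_mono)
  ultimately have w: "(norm w)\<^sup>2 \<le> 6 * \<gamma>\<^sup>2 * D + 12 * \<gamma>\<^sup>2 * (norm e)\<^sup>2 + 3 * (norm p)\<^sup>2"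
    by (simp add: algebra_simps)
  then show ?thesis2 by (simp add: w_def D_def)
  have \<gamma>2: "\<gamma>\<^sup>2 \<le> \<gamma> / 480"
    using g by (simp add: power2_eq_square mult_left_le)
  have "2 * (x \<bullet> p) \<le> \<gamma> * q / 2 * (norm x)\<^sup>2 + 2 / (\<gamma> * q) * (norm p)\<^sup>2"
    using power2_norm_add_le(2)[of "\<gamma> * q / 2" x p] g q by simp
  also have "\<gamma> * q / 2 * (norm x)\<^sup>2 \<le> \<gamma> * D / 2"
    using mult_left_mono[OF D(1), of \<gamma>] g by simp
  finally have xp: "2 * (x \<bullet> p) \<le> \<gamma> * D / 2 + 2 / (\<gamma> * q) * (norm p)\<^sup>2" by simp
  have xv: "\<gamma> * (2 * (x \<bullet> v)) \<le> \<gamma> * (D / 4 + 8 * (norm e)\<^sup>2)"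
    using D(3) g by (intro mult_left_mono) auto
  have gq: "0 < \<gamma> * q" "\<gamma> * q \<le> 1 / 480"
    using g q mult_mono[of \<gamma> "1 / 480" q 1] by auto
  then have "3 \<le> 0.1 / (\<gamma> * q)"
    by (simp add: field_simps)
  then have "3 * (norm p)\<^sup>2 \<le> 0.1 / (\<gamma> * q) * (norm p)\<^sup>2"
    by (intro mult_right_mono) auto
  moreover have "\<gamma>\<^sup>2 * D \<le> \<gamma> / 480 * D" "\<gamma>\<^sup>2 * (norm e)\<^sup>2 \<le> \<gamma> / 480 * (norm e)\<^sup>2"
    by (intro mult_right_mono \<gamma>2 D zero_le_power2)+
  moreover have "0 \<le> \<gamma> * D" "0 \<le> \<gamma> * (norm e)\<^sup>2"
    using g D by auto
  moreover have "(norm (x + w))\<^sup>2 = (norm x)\<^sup>2 + 2 * (x \<bullet> w) + (norm w)\<^sup>2"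
    by (simp add: power2_norm_eq_inner inner_add_left inner_add_right inner_commute)
  moreover have "x \<bullet> w = - \<gamma> * D + \<gamma> * (x \<bullet> v) + x \<bullet> p"
    by (simp add: D_def w_def inner_add_right inner_diff_right)
  moreover have "2.1 / (\<gamma> * q) * (norm p)\<^sup>2 = 2 / (\<gamma> * q) * (norm p)\<^sup>2 + 0.1 / (\<gamma> * q) * (norm p)\<^sup>2"
    by (simp add: field_simps)
  ultimately have main: "(norm (x + w))\<^sup>2 \<le> (norm x)\<^sup>2 - 1.2 * (\<gamma> * D) + 8.1 * (\<gamma> * (norm e)\<^sup>2) + 2.1 / (\<gamma> * q) * (norm p)\<^sup>2"
    using w xp xv by (simp add: algebra_simps)
  have eq: "x - \<gamma> *\<^sub>R u + \<gamma> *\<^sub>R v + p = x + w"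
    by (simp add: w_def)
  show ?thesis1
    using main unfolding eq by (simp add: D_def mult.assoc)
qed

lemma mixing_step:
  fixes X A Q P X' :: "real^'d::finite^'n::finite"
  assumes col: "\<And>j. (\<Sum>i\<in>UNIV. W $ i $ j) = 1" and row: "\<And>i. (\<Sum>j\<in>UNIV. W $ i $ j) = 1"
    and sigma: "\<sigma> = spectral_norm (W - (\<chi> i j. c))" "0 \<le> \<sigma>" "\<sigma> < 1"
    and g: "0 < \<gamma>" "\<gamma> \<le> 1 / 480"
    and X': "X' = X - \<gamma> *\<^sub>R (A - mix W A + Q - mix W Q) + P"
  defines "x \<equiv> X - rep (avg X)" and "D \<equiv> (X - rep (avg X)) \<bullet> (X - mix W X)"
  shows "avg X' = avg X + avg P"
    and "(norm (X' - rep (avg X')))\<^sup>2 \<le> (norm x)\<^sup>2 - 1.2 * \<gamma> * D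
           + 8.1 * \<gamma> * (norm (X - A - Q))\<^sup>2 + 2.1 / (\<gamma> * (1 - \<sigma>)) * (norm (P - rep (avg P)))\<^sup>2"
    and "(norm (X' - X))\<^sup>2 \<le> 6 * \<gamma>\<^sup>2 * D + 12 * \<gamma>\<^sup>2 * (norm (X - A - Q))\<^sup>2 + 3 * (norm P)\<^sup>2"
    and "(1 - \<sigma>) * (norm x)\<^sup>2 \<le> D"
proof -
  define e where "e = X - A - Q"
  have x: "avg x = 0" "x - mix W x = X - mix W X"
    by (simp_all add: x_def mix_simps mix_rep[OF row])
  have D: "D = x \<bullet> (x - mix W x)"
    by (simp only: D_def x_def[symmetric] x)
  \<comment> \<open>\<open>A + Q\<close> is \<open>X\<close> minus the compression error
    \<open>e\<close>, and the consensus part of \<open>X\<close> is invisible to the Laplacian. So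
    the step is exact mixing of the deviation, disturbed by \<open>e\<close> and
    \<open>P\<close>.\<close>
  have "A - mix W A + Q - mix W Q = (x - mix W x) - (e - mix W e)"
    by (simp add: x e_def mix_simps)
  then have diff: "X' - X = - \<gamma> *\<^sub>R (x - mix W x) + \<gamma> *\<^sub>R (e - mix W e) + P"
    by (simp add: X' scaleR_diff_right)
  show avg: "avg X' = avg X + avg P"
    by (simp add: X' avg_mix[OF col])
  have dev: "X' - rep (avg X') = x - \<gamma> *\<^sub>R (x - mix W x) + \<gamma> *\<^sub>R (e - mix W e) + (P - rep (avg P))"
    using diff unfolding avg by (simp add: x_def algebra_simps)
  note N = laplacian_bounds[OF col row sigma(1,2) less_imp_le[OF sigma(3)] x(1)]
  have q: "0 < 1 - \<sigma>" "1 - \<sigma> \<le> 1"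
    using sigma by auto
  note S = contraction_step[OF N(1,2) N(3,4)[of e] q g]
  show "(norm (X' - rep (avg X')))\<^sup>2 \<le> (norm x)\<^sup>2 - 1.2 * \<gamma> * D
           + 8.1 * \<gamma> * (norm (X - A - Q))\<^sup>2 + 2.1 / (\<gamma> * (1 - \<sigma>)) * (norm (P - rep (avg P)))\<^sup>2"
    unfolding D dev e_def[symmetric] by (rule S(1))
  show "(norm (X' - X))\<^sup>2 \<le> 6 * \<gamma>\<^sup>2 * D + 12 * \<gamma>\<^sup>2 * (norm (X - A - Q))\<^sup>2 + 3 * (norm P)\<^sup>2"
    unfolding D diff e_def[symmetric] by (rule S(2))
  show "(1 - \<sigma>) * (norm x)\<^sup>2 \<le> D"
    unfolding D by (rule N(1))
qed

text \<open>\<open>compression_excess r \<psi> Z Q\<close> has nonpositive expectation if \<open>Q\<close> is a compression of \<open>Z\<close>.\<close>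

definition compression_excess :: "real \<Rightarrow> real \<Rightarrow> 'a::real_inner \<Rightarrow> 'a \<Rightarrow> real" where
  "compression_excess r \<psi> Z Q = (norm ((1 / r) *\<^sub>R Q - Z))\<^sup>2 - (1 - \<psi>) * (norm Z)\<^sup>2"

text \<open>Origin of the constant \<open>C\<close>: \<open>Z - Q\<close> splits into
  \<open>1 - r\<close> times \<open>Z\<close> and \<open>- r\<close> times the error of the rescaled
  compressor, whose square is \<open>1 - \<psi>\<close> times that of \<open>Z\<close> plus the
  excess.\<close>

lemma compression_error:
  fixes Z Q :: "'a::real_inner"
  assumes "0 < r"
  shows "(norm (Z - Q))\<^sup>2 \<le> (2 * r\<^sup>2 * (1 - \<psi>) + 2 * (1 - r)\<^sup>2) * (norm Z)\<^sup>2
           + 2 * r\<^sup>2 * compression_excess r \<psi> Z Q"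
proof -
  have "Z - Q = (1 - r) *\<^sub>R Z + (- r) *\<^sub>R ((1 / r) *\<^sub>R Q - Z)"
    using assms by (simp add: algebra_simps)
  then have "(norm (Z - Q))\<^sup>2 \<le> 2 * (norm ((1 - r) *\<^sub>R Z))\<^sup>2 + 2 * (norm ((- r) *\<^sub>R ((1 / r) *\<^sub>R Q - Z)))\<^sup>2"
    using power2_norm_add_le(1)[of 1 "(1 - r) *\<^sub>R Z" "(- r) *\<^sub>R ((1 / r) *\<^sub>R Q - Z)"]
    by (simp only:) simp
  then show ?thesis
    unfolding norm_scaleR power_mult_distrib power2_abs
    by (simp add: compression_excess_def algebra_simps)
qed

text \<open>With \<open>a = f * r\<close> in [0, 1], the new difference is a convex combination of
  \<open>Z\<close> and \<open>- T\<close>, where \<open>T\<close> is the rescaled compression error.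
  Convexity of the squared norm, in its exact form with the dropped remainder, gives the
  bound.\<close>

lemma compression_progress:
  fixes Z Q :: "'a::real_inner"
  assumes r: "0 < r" and f: "0 \<le> f" "f * r \<le> 1"
  shows "(norm (Z - f *\<^sub>R Q))\<^sup>2 \<le> (1 - f * \<psi> * r) * (norm Z)\<^sup>2 + f * r * compression_excess r \<psi> Z Q"
proof -
  define T where "T = (1 / r) *\<^sub>R Q - Z"
  define a where "a = f * r"
  have eq: "Z - f *\<^sub>R Q = (1 - a) *\<^sub>R Z - a *\<^sub>R T"
    using r by (simp add: T_def a_def algebra_simps)
  have "(norm ((1 - a) *\<^sub>R Z - a *\<^sub>R T))\<^sup>2 = (1 - a) * (norm Z)\<^sup>2 + a * (norm T)\<^sup>2 - a * (1 - a) * (norm (Z + T))\<^sup>2"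
    by (simp add: power2_norm_eq_inner inner_diff_left inner_diff_right inner_add_left inner_add_right inner_commute
        algebra_simps)
  moreover have "0 \<le> a * (1 - a) * (norm (Z + T))\<^sup>2"
    using f r by (simp add: a_def)
  ultimately show ?thesis
    unfolding eq by (simp add: compression_excess_def a_def T_def algebra_simps)
qed

text \<open>The compressed update contracts by \<open>1 - 2 * c\<close>. Young with weight
  \<open>c\<close> for the displacement of \<open>X\<close> spends half of this gain, since
  \<open>(1 + c) * (1 - 2 * c) \<le> 1 - c\<close>.\<close>

lemma tracking_step:
  fixes X A Q X' :: "'a::real_inner"
  assumes r: "0 < r" and f: "0 \<le> f" "f * r \<le> 1" and c: "c = f * \<psi> * r / 2" "0 < c"
  shows "(norm (X' - (A + f *\<^sub>R Q)))\<^sup>2 \<le> (1 - c) * (norm (X - A))\<^sup>2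
     + (1 + c) * f * r * compression_excess r \<psi> (X - A) Q + (1 + 1 / c) * (norm (X' - X))\<^sup>2"
proof -
  have c_eq: "f * \<psi> * r = 2 * c"
    using c(1) by simp
  have "(norm (X' - (A + f *\<^sub>R Q)))\<^sup>2 \<le> (1 + c) * (norm (X - A - f *\<^sub>R Q))\<^sup>2 + (1 + 1 / c) * (norm (X' - X))\<^sup>2"
    using power2_norm_add_le(1)[OF c(2), of "X - A - f *\<^sub>R Q" "X' - X"] by (simp add: algebra_simps)
  also have "(1 + c) * (norm (X - A - f *\<^sub>R Q))\<^sup>2
      \<le> (1 + c) * ((1 - 2 * c) * (norm (X - A))\<^sup>2 + f * r * compression_excess r \<psi> (X - A) Q)"
    using compression_progress[OF r f, of "X - A" Q \<psi>] c(2) unfolding c_eq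
    by (intro mult_left_mono) auto
  also have "\<dots> = (1 - c - 2 * c\<^sup>2) * (norm (X - A))\<^sup>2 + (1 + c) * f * r * compression_excess r \<psi> (X - A) Q"
    by (simp add: algebra_simps power2_eq_square)
  also have "(1 - c - 2 * c\<^sup>2) * (norm (X - A))\<^sup>2 \<le> (1 - c) * (norm (X - A))\<^sup>2"
    by (intro mult_right_mono) auto
  finally show ?thesis by simp
qed

section \<open>Decrease of the potential\<close>

text \<open>The parameter \<open>q\<close> stands for \<open>1 - \<sigma>\<close>.\<close>

locale step_sizes =
  fixes q L \<gamma> \<eta> c1 c2 C \<phi> :: real
  assumes q: "0 < q" "q \<le> 1" and L: "0 < L" and g: "0 < \<gamma>" and h: "0 < \<eta>"
    and c1: "0 < c1" and c2: "0 < c2" and C: "0 \<le> C"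
    and b1: "\<gamma> * (1 + 1 / c1) \<le> q / 160" and b2: "\<gamma> * (1 + 1 / c2) * L\<^sup>2 \<le> q / 40000"
    and b3: "\<gamma> * C \<le> c1 * q / 40" and b4: "\<gamma> * C \<le> c2 * L\<^sup>2"
    and e1: "\<eta> * L \<le> q\<^sup>2 * \<gamma> / 40" and e2: "\<eta> * L\<^sup>2 \<le> 0.4 * q * \<gamma>"
    and e3: "\<eta> \<le> \<gamma>" and e4: "\<eta> * L \<le> 1 / 2"
    and phi: "\<phi> = q\<^sup>2 / (320 * L\<^sup>2)"
begin

lemma phi_pos: "0 < \<phi>"
  using q L by (simp add: phi)

lemma phi_L2: "\<phi> * L\<^sup>2 = q\<^sup>2 / 320"
  using L by (simp add: phi)

text \<open>The second bound is the square of \<open>e1\<close>, with 0.2 = 320/1600. It lets the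
  dissipation of \<open>Y\<close> absorb the disturbance that the term \<open>- \<eta> Y\<close>
  causes in the consensus of \<open>X\<close>.\<close>

lemma eta2_le: "\<eta>\<^sup>2 / \<gamma> \<le> \<eta>" "\<eta>\<^sup>2 / (\<gamma> * q) \<le> 0.2 * (\<phi> * (\<gamma> * q))"
proof -
  show "\<eta>\<^sup>2 / \<gamma> \<le> \<eta>"
    using e3 g h by (simp add: power2_eq_square field_simps)
  have "(\<eta> * L)\<^sup>2 \<le> (q\<^sup>2 * \<gamma> / 40)\<^sup>2"
    using e1 h L by (intro power_mono) auto
  also have "\<dots> = 0.2 * (\<phi> * L\<^sup>2) * (\<gamma> * q)\<^sup>2"
    unfolding phi_L2 by (simp add: power2_eq_square)
  finally have "\<eta>\<^sup>2 * L\<^sup>2 \<le> 0.2 * \<phi> * (\<gamma> * q)\<^sup>2 * L\<^sup>2"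
    by (simp add: power_mult_distrib mult_ac)
  then have "\<eta>\<^sup>2 \<le> 0.2 * \<phi> * (\<gamma> * q)\<^sup>2"
    using L by (simp add: mult_le_cancel_right)
  then have "\<eta>\<^sup>2 / (\<gamma> * q) \<le> 0.2 * \<phi> * (\<gamma> * q)\<^sup>2 / (\<gamma> * q)"
    using g q by (intro divide_right_mono) auto
  then show "\<eta>\<^sup>2 / (\<gamma> * q) \<le> 0.2 * (\<phi> * (\<gamma> * q))"
    using g q by (simp add: power2_eq_square)
qed

text \<open>The whole absorption argument on plain reals. \<open>x2\<close>, \<open>y2\<close> are
  squared deviations from average, \<open>Dx\<close>, \<open>Dy\<close> their dissipations,
  \<open>zx\<close>, \<open>zy\<close> squared distances to the references \<open>A\<close> and
  \<open>C\<close>, \<open>ex\<close>, \<open>ey\<close> squared compression errors with excesses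
  \<open>\<tau>x\<close>, \<open>\<tau>y\<close>, \<open>w\<close>, \<open>v\<close> squared
  displacements of \<open>X\<close> and \<open>Y\<close>. \<open>f\<close> is the cost gap,
  \<open>gF\<close> the squared gradient of the average cost and \<open>gy\<close> the squared
  average of \<open>Y\<close>, each times the number of agents. Primes mark the next time.\<close>

lemma lyapunov_arith:
  assumes nonneg: "0 \<le> y2" "0 \<le> w" "0 \<le> ex" "0 \<le> ey" "0 \<le> gy" "0 \<le> zx" "0 \<le> zy" "0 \<le> x2"
    and Dx: "q * x2 \<le> Dx" and Dy: "q * y2 \<le> Dy"
    and x2': "x2' \<le> x2 - 1.2 * \<gamma> * Dx + 8.1 * \<gamma> * ex + 2.1 / (\<gamma> * q) * (\<eta>\<^sup>2 * y2)"
    and y2': "y2' \<le> y2 - 1.2 * \<gamma> * Dy + 8.1 * \<gamma> * ey + 2.1 / (\<gamma> * q) * (L\<^sup>2 * w)"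
    and w: "w \<le> 6 * \<gamma>\<^sup>2 * Dx + 12 * \<gamma>\<^sup>2 * ex + 3 * (\<eta>\<^sup>2 * (y2 + gy))"
    and v: "v \<le> 6 * \<gamma>\<^sup>2 * Dy + 12 * \<gamma>\<^sup>2 * ey + 3 * (L\<^sup>2 * w)"
    and zx': "zx' \<le> (1 - c1) * zx + a1 * \<tau>x + (1 + 1 / c1) * w"
    and zy': "zy' \<le> (1 - c2) * zy + a2 * \<tau>y + (1 + 1 / c2) * v"
    and ex: "ex \<le> C * zx + a0 * \<tau>x" and ey: "ey \<le> C * zy + a0 * \<tau>y"
    and f': "f' \<le> f - \<eta> / 2 * gF - (\<eta> / 2 - L * \<eta>\<^sup>2 / 2) * gy + \<eta> / 2 * L\<^sup>2 * x2"
  shows "x2' + \<phi> * y2' + zx' + q * zy' + f'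
    \<le> (1 - 0.9 * \<gamma> * q) * x2 + (1 - 0.7 * \<gamma> * q) * (\<phi> * y2) + (1 - 0.7 * c1) * zx + (1 - 0.9 * c2) * (q * zy)
      + f - \<eta> / 2 * gF + (a1 + 8.3 * \<gamma> * a0) * \<tau>x + (q * a2 + 8.2 * \<phi> * \<gamma> * a0) * \<tau>y"
proof -
  have Dx0: "0 \<le> Dx" and Dy0: "0 \<le> Dy"
    using Dx Dy nonneg q by (auto intro: order_trans[rotated])
  \<comment> \<open>The displacement \<open>w\<close> enters three times: as gradient change in the
    deviation of \<open>Y\<close>, as motion of \<open>X\<close> relative to \<open>A\<close>, and
    through the displacement of \<open>Y\<close> relative to its reference. \<open>K\<close> is its
    total weight; 2.1/320 + 1/160 + 3/40000 < 1/60 gives the bound on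
    \<open>\<gamma> * K\<close>.\<close>
  define K where "K = \<phi> * (2.1 / (\<gamma> * q) * L\<^sup>2) + (1 + 1 / c1) + 3 * q * (1 + 1 / c2) * L\<^sup>2"
  have "\<gamma> * K = (2.1 / q) * (\<phi> * L\<^sup>2) + \<gamma> * (1 + 1 / c1) + 3 * q * (\<gamma> * (1 + 1 / c2) * L\<^sup>2)"
    using g q by (simp add: K_def field_simps)
  also have "\<dots> \<le> (2.1 / q) * (q\<^sup>2 / 320) + q / 160 + 3 * q * (q / 40000)"
    unfolding phi_L2 using b1 b2 q by (intro add_mono mult_left_mono) auto
  also have "\<dots> = q * (2.1 / 320) + q / 160 + q * q * (3 / 40000)"
    using q by (simp add: power2_eq_square)
  also have "\<dots> \<le> q * (2.1 / 320) + q / 160 + q * (3 / 40000)"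
    using q by (intro add_mono mult_right_mono) (auto simp: mult_left_le)
  also have "\<dots> \<le> q / 60"
    using q by simp
  finally have K: "\<gamma> * K \<le> q / 60" .
  define t where "t = \<eta>\<^sup>2 / \<gamma>"
  have t: "0 \<le> t"
    using g by (simp add: t_def)
  have "0 \<le> 6 * \<gamma>\<^sup>2 * Dx + 12 * \<gamma>\<^sup>2 * ex + 3 * (\<eta>\<^sup>2 * (y2 + gy))"
    using Dx0 nonneg by simp
  moreover have "0 \<le> K"
    using c1 c2 q g phi_pos by (simp add: K_def)
  ultimately have "K * w \<le> (\<gamma> * K) * ((6 * \<gamma>\<^sup>2 * Dx + 12 * \<gamma>\<^sup>2 * ex + 3 * (\<eta>\<^sup>2 * (y2 + gy))) / \<gamma>)"
    using mult_left_mono[OF w, of K] g by simp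
  also have "\<dots> \<le> q / 60 * ((6 * \<gamma>\<^sup>2 * Dx + 12 * \<gamma>\<^sup>2 * ex + 3 * (\<eta>\<^sup>2 * (y2 + gy))) / \<gamma>)"
    using K g Dx0 nonneg by (intro mult_right_mono) auto
  also have "\<dots> = q * (0.1 * (\<gamma> * Dx) + 0.2 * (\<gamma> * ex) + 1 / 20 * (t * (y2 + gy)))"
    using g by (simp add: t_def power2_eq_square field_simps)
  also have "\<dots> \<le> 1 * (0.1 * (\<gamma> * Dx) + 0.2 * (\<gamma> * ex) + 1 / 20 * (t * (y2 + gy)))"
    using q g t Dx0 nonneg by (intro mult_right_mono) auto
  finally have Kw_t: "K * w \<le> 0.1 * (\<gamma> * Dx) + 0.2 * (\<gamma> * ex) + 1 / 20 * (t * y2) + 1 / 20 * (t * gy)"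
    by (simp add: algebra_simps add_divide_distrib)

  note Kw = Kw_t[unfolded t_def]
  have y2bd: "\<eta>\<^sup>2 / (\<gamma> * q) * y2 \<le> 0.2 * (\<gamma> * q * (\<phi> * y2))"
    using mult_right_mono[OF eta2_le(2) nonneg(1)] by (simp add: mult_ac)
  have "\<eta>\<^sup>2 / \<gamma> \<le> \<eta>\<^sup>2 / (\<gamma> * q)"
    using q g by (intro divide_left_mono) (auto simp: mult_left_le)
  from mult_right_mono[OF this nonneg(1)]
  have y2bd': "\<eta>\<^sup>2 / \<gamma> * y2 \<le> \<eta>\<^sup>2 / (\<gamma> * q) * y2" .
  have gybd: "\<eta>\<^sup>2 / \<gamma> * gy \<le> \<eta> * gy"
    using eta2_le(1) nonneg by (intro mult_right_mono)
  have "L * \<eta>\<^sup>2 \<le> \<eta> / 2"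
    using mult_left_mono[OF e4, of \<eta>] h by (simp add: power2_eq_square mult_ac)
  then have gybd': "(L * \<eta>\<^sup>2) * gy \<le> \<eta> / 2 * gy"
    using nonneg by (intro mult_right_mono)
  have f2: "\<eta> * L\<^sup>2 * x2 \<le> 0.4 * (\<gamma> * q * x2)"
    using mult_right_mono[OF e2 nonneg(8)] by (simp add: mult_ac)
  have Dxb: "\<gamma> * q * x2 \<le> \<gamma> * Dx" and Dyb: "\<gamma> * q * (\<phi> * y2) \<le> \<phi> * \<gamma> * Dy"
    using mult_left_mono[OF Dx, of \<gamma>] mult_left_mono[OF Dy, of "\<phi> * \<gamma>"] g phi_pos by (simp_all add: mult_ac)

  \<comment> \<open>The lowered weight \<open>q\<close> supplies the second factor \<open>q\<close>
    that matches \<open>\<phi>\<close>: 320/40000 = 8/1000.\<close>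
  have "q * (\<gamma> * (1 + 1 / c2)) * L\<^sup>2 \<le> q * (q / 40000)"
    using mult_left_mono[OF b2, of q] q by (simp add: mult_ac)
  also have "\<dots> = 8 / 1000 * \<phi> * L\<^sup>2"
    using L by (simp add: phi power2_eq_square)
  finally have "q * (\<gamma> * (1 + 1 / c2)) \<le> 8 / 1000 * \<phi>"
    by (rule mult_right_le_imp_le) (use L in simp)
  then have "q * (\<gamma> * (1 + 1 / c2)) * (\<gamma> * (6 * Dy + 12 * ey)) \<le> 8 / 1000 * \<phi> * (\<gamma> * (6 * Dy + 12 * ey))"
    using g Dy0 nonneg by (intro mult_right_mono) auto
  then have vb: "q * ((1 + 1 / c2) * (6 * \<gamma>\<^sup>2 * Dy + 12 * \<gamma>\<^sup>2 * ey)) \<le> 48 / 1000 * (\<phi> * \<gamma> * Dy) + 96 / 1000 * (\<phi> * \<gamma> * ey)"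
    by (simp add: power2_eq_square algebra_simps)

  have exb: "8.3 * \<gamma> * ex \<le> 21 / 100 * (c1 * zx) + 8.3 * \<gamma> * a0 * \<tau>x"
  proof -
    have "\<gamma> * ex \<le> \<gamma> * C * zx + \<gamma> * a0 * \<tau>x"
      using mult_left_mono[OF ex, of \<gamma>] g by (simp add: algebra_simps)
    moreover have "\<gamma> * C * zx \<le> c1 * q / 40 * zx"
      using b3 nonneg by (intro mult_right_mono)
    moreover have "c1 * zx * q \<le> c1 * zx * 1"
      using q c1 nonneg by (intro mult_left_mono) auto
    moreover have "0 \<le> c1 * zx"
      using c1 nonneg by simp
    ultimately show ?thesis by (simp add: mult_ac)
  qed
  have eyb: "8.2 * (\<phi> * \<gamma> * ey) \<le> 3 / 100 * (q * (c2 * zy)) + 8.2 * \<phi> * \<gamma> * a0 * \<tau>y"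
  proof -
    have "\<phi> * \<gamma> * ey \<le> \<phi> * (\<gamma> * C) * zy + \<phi> * \<gamma> * a0 * \<tau>y"
      using mult_left_mono[OF ey, of "\<phi> * \<gamma>"] g phi_pos by (simp add: algebra_simps)
    moreover have "\<phi> * (\<gamma> * C) * zy \<le> q * (q * (c2 * zy)) / 320"
    proof -
      have "\<phi> * (\<gamma> * C) * zy \<le> \<phi> * (c2 * L\<^sup>2) * zy"
        using b4 nonneg phi_pos by (intro mult_right_mono mult_left_mono) auto
      also have "\<dots> = (\<phi> * L\<^sup>2) * (c2 * zy)"
        by (simp add: mult_ac)
      finally show ?thesis
        unfolding phi_L2 by (simp add: power2_eq_square)
    qed
    moreover have "q * (q * (c2 * zy)) \<le> 1 * (q * (c2 * zy))"
      using q c2 nonneg by (intro mult_right_mono) auto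
    moreover have "0 \<le> q * (c2 * zy)"
      using q c2 nonneg by simp
    ultimately show ?thesis by (simp add: mult_ac)
  qed
  have "\<phi> * y2' \<le> \<phi> * (y2 - 1.2 * \<gamma> * Dy + 8.1 * \<gamma> * ey + 2.1 / (\<gamma> * q) * (L\<^sup>2 * w))"
    using y2' phi_pos by (intro mult_left_mono) auto
  then have Y: "\<phi> * y2' \<le> \<phi> * y2 - 1.2 * (\<phi> * \<gamma> * Dy) + 8.1 * (\<phi> * \<gamma> * ey) + \<phi> * (2.1 / (\<gamma> * q) * L\<^sup>2) * w"
    by (simp add: algebra_simps)
  have "(1 + 1 / c2) * v \<le> (1 + 1 / c2) * (6 * \<gamma>\<^sup>2 * Dy + 12 * \<gamma>\<^sup>2 * ey + 3 * (L\<^sup>2 * w))"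
    using v c2 by (intro mult_left_mono) auto
  with zy' have "zy' \<le> (1 - c2) * zy + a2 * \<tau>y + (1 + 1 / c2) * (6 * \<gamma>\<^sup>2 * Dy + 12 * \<gamma>\<^sup>2 * ey + 3 * (L\<^sup>2 * w))"
    by linarith
  then have "q * zy' \<le> q * ((1 - c2) * zy + a2 * \<tau>y + (1 + 1 / c2) * (6 * \<gamma>\<^sup>2 * Dy + 12 * \<gamma>\<^sup>2 * ey + 3 * (L\<^sup>2 * w)))"
    using q by (intro mult_left_mono) auto
  then have ZY: "q * zy' \<le> q * zy - q * (c2 * zy) + q * a2 * \<tau>y
      + q * ((1 + 1 / c2) * (6 * \<gamma>\<^sup>2 * Dy + 12 * \<gamma>\<^sup>2 * ey)) + 3 * q * (1 + 1 / c2) * L\<^sup>2 * w"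
    by (simp add: algebra_simps)
  have Kw': "K * w = \<phi> * (2.1 / (\<gamma> * q) * L\<^sup>2) * w + (1 + 1 / c1) * w + 3 * q * (1 + 1 / c2) * L\<^sup>2 * w"
    by (simp only: K_def distrib_right)
  have X: "x2' \<le> x2 - 1.2 * (\<gamma> * Dx) + 8.1 * (\<gamma> * ex) + 2.1 * (\<eta>\<^sup>2 / (\<gamma> * q) * y2)"
    using x2' by (simp add: mult_ac)
  have ZX: "zx' \<le> zx - c1 * zx + a1 * \<tau>x + (1 + 1 / c1) * w"
    using zx' by (simp add: algebra_simps)
  have F: "f' \<le> f - \<eta> / 2 * gF - \<eta> * gy / 2 + (L * \<eta>\<^sup>2) * gy / 2 + \<eta> * L\<^sup>2 * x2 / 2"
    using f' by (simp add: algebra_simps)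
  have nn: "0 \<le> \<gamma> * ex" "0 \<le> \<phi> * \<gamma> * ey" "0 \<le> \<gamma> * Dx" "0 \<le> \<phi> * \<gamma> * Dy" "0 \<le> \<gamma> * q * x2"
     "0 \<le> \<gamma> * q * (\<phi> * y2)" "0 \<le> c1 * zx" "0 \<le> q * (c2 * zy)" "0 \<le> \<eta> * gy"
    using g q h phi_pos c1 c2 nonneg Dx0 Dy0 by simp_all
  \<comment> \<open>Naming the products leaves an inequality linear in its atoms. The budget: for
    \<open>x2\<close>, 1.2 - 0.1 - 0.2 = 0.9; for \<open>y2\<close>, 1.2 - 0.048 - 0.42 - 0.01 >
    0.7; for \<open>zx\<close>, 1 - 0.21 > 0.7; for \<open>zy\<close>, 1 - 0.03 > 0.9; for
    \<open>gy\<close>, 1/2 - 1/4 - 1/20 > 0 in units of \<open>\<eta>\<close>.\<close>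
  define T1 T2 T3 where "T1 = \<eta>\<^sup>2 / (\<gamma> * q) * y2" and "T2 = \<eta>\<^sup>2 / \<gamma> * y2" and "T3 = \<eta>\<^sup>2 / \<gamma> * gy"
  define w1 w2 w3 where "w1 = \<phi> * (2.1 / (\<gamma> * q) * L\<^sup>2) * w" and "w2 = (1 + 1 / c1) * w"
    and "w3 = 3 * q * (1 + 1 / c2) * L\<^sup>2 * w"
  define v1 where "v1 = q * ((1 + 1 / c2) * (6 * \<gamma>\<^sup>2 * Dy + 12 * \<gamma>\<^sup>2 * ey))"
  note defs = T1_def T2_def T3_def w1_def w2_def w3_def v1_def
  have "x2' + \<phi> * y2' + zx' + q * zy' + f'
    \<le> x2 - 0.9 * (\<gamma> * q * x2) + \<phi> * y2 - 0.7 * (\<gamma> * q * (\<phi> * y2)) + zx - 0.7 * (c1 * zx) + q * zy - 0.9 * (q * (c2 * zy))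
      + f - \<eta> / 2 * gF + a1 * \<tau>x + 8.3 * \<gamma> * a0 * \<tau>x + q * a2 * \<tau>y + 8.2 * \<phi> * \<gamma> * a0 * \<tau>y"
    using X[folded defs] Y[folded defs] ZX[folded defs] ZY[folded defs] F Kw[folded defs] Kw'[folded defs]
      y2bd[folded defs] y2bd'[folded defs] gybd[folded defs] gybd' f2 Dxb Dyb vb[folded defs] exb eyb nn
    by linarith
  then show ?thesis by (simp add: algebra_simps)
qed

end

lemma norm_rep_avg_le:
  fixes X :: "real^'d::finite^'n::finite"
  shows "(norm (rep (avg X) :: real^'d^'n))\<^sup>2 \<le> (norm X)\<^sup>2"
  by (simp add: norm_decomp[of X])

text \<open>Compared with \<open>lyapunov_U\<close>, the weight of the compression error of \<open>Y\<close> is lowered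
  from \<open>1\<close> to \<open>q = 1 - \<sigma>\<close>. That error grows by about \<open>\<gamma>\<^sup>2 (1 + 1 / c2)\<close> times the dissipation of
  \<open>Y\<close>, whose own term only yields \<open>\<phi> \<gamma>\<close> times it. As \<open>\<phi>\<close> is of order \<open>q\<^sup>2\<close> and the bound on \<open>\<gamma>\<close>
  only of order \<open>q\<close>, the weight \<open>1\<close> would not do for small \<open>q\<close>.\<close>

definition potential ::
  "real \<Rightarrow> ('n::finite \<Rightarrow> real^'d::finite \<Rightarrow> real) \<Rightarrow> real \<Rightarrow>
   real \<Rightarrow> real^'d^'n \<Rightarrow> real^'d^'n \<Rightarrow> real^'d^'n \<Rightarrow> real^'d^'n \<Rightarrow> real" where
  "potential q F Fstar \<phi> X Y A C =
     (norm (X - rep (avg X)))\<^sup>2 + \<phi> * (norm (Y - rep (avg Y)))\<^sup>2 + (norm (X - A))\<^sup>2 + q * (norm (Y - C))\<^sup>2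
       + real CARD('n) * (avg_cost F (avg X) - Fstar)"

section \<open>The one-step inequality for vectors, still without probability\<close>

locale compressed_tracking = step_sizes "1 - \<sigma>" L \<gamma> \<eta> c1 c2 C \<phi>
  for \<sigma> L \<gamma> \<eta> c1 c2 C \<phi> :: real +
  fixes W :: "real^'n::finite^'n" and F :: "'n \<Rightarrow> real^'d::finite \<Rightarrow> real"
    and r \<psi> \<phi>X \<phi>Y Fstar :: real
  assumes row: "\<And>i. (\<Sum>j\<in>UNIV. W $ i $ j) = 1" and col: "\<And>j. (\<Sum>i\<in>UNIV. W $ i $ j) = 1"
    and sigma: "\<sigma> = spectral_norm (W - (\<chi> i j. 1 / real CARD('n)))"
    and diff: "\<And>i x. F i differentiable at x"
    and lipschitz: "\<And>i x y. norm (gradient (F i) x - gradient (F i) y) \<le> L * norm (x - y)"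
    and Fstar_le: "\<And>x. Fstar \<le> avg_cost F x"
    and r: "0 < r" and phiX: "0 \<le> \<phi>X" "\<phi>X * r \<le> 1" and phiY: "0 \<le> \<phi>Y" "\<phi>Y * r \<le> 1"
    and c1_eq: "c1 = \<phi>X * \<psi> * r / 2" and c2_eq: "c2 = \<phi>Y * \<psi> * r / 2"
    and C_eq: "C = 2 * r\<^sup>2 * (1 - \<psi>) + 2 * (1 - r)\<^sup>2"
    and c1_le: "c1 \<le> 1 / 2"
begin

text \<open>Since \<open>c1 \<le> 1 / 2\<close>, the factor \<open>1 + 1 / c1\<close> is at least 3,
  and 3 * 160 = 480.\<close>

lemma gamma_le: "\<gamma> \<le> 1 / 480"
proof -
  have "3 \<le> 1 + 1 / c1"
    using c1 c1_le by (simp add: field_simps)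
  then have "\<gamma> * 3 \<le> \<gamma> * (1 + 1 / c1)"
    using g by (intro mult_left_mono) auto
  also have "\<dots> \<le> (1 - \<sigma>) / 160" by (rule b1)
  finally show ?thesis using q by simp
qed

lemma norm_grads_diff_le: "(norm (grads F X - grads F Y))\<^sup>2 \<le> L\<^sup>2 * (norm (X - Y))\<^sup>2"
proof -
  have "(norm (grads F X - grads F Y))\<^sup>2 \<le> (\<Sum>i\<in>UNIV. (L * norm (X $ i - Y $ i))\<^sup>2)"
    unfolding norm_vec_power2[where 'n='n]
    by (intro sum_mono power_mono) (auto simp: grads_def lipschitz)
  also have "\<dots> = L\<^sup>2 * (norm (X - Y))\<^sup>2"
    by (simp add: norm_vec_power2[where 'n='n] power_mult_distrib sum_distrib_left)
  finally show ?thesis .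
qed

lemma GDERIV_avg: "GDERIV (avg_cost F) x :> avg (grads F (rep x))"
  using GDERIV_avg_cost[of F x, OF diff] by (simp add: grads_def rep_def)

lemma gradient_avg: "gradient (avg_cost F) x = avg (grads F (rep x))"
  by (rule gradient_eqI[OF GDERIV_avg])

lemma avg_grads_diff_le:
  "real CARD('n) * (norm (avg (grads F X) - avg (grads F Y)))\<^sup>2 \<le> L\<^sup>2 * (norm (X - Y))\<^sup>2"
  using order_trans[OF norm_rep_avg_le[of "grads F X - grads F Y"] norm_grads_diff_le[of X Y]]
  by (simp add: norm_rep_power2 flip: rep_simps)

lemma avg_cost_descent:
  "avg_cost F (x + h) \<le> avg_cost F x + gradient (avg_cost F) x \<bullet> h + L / 2 * (norm h)\<^sup>2"
proof -
  have "norm (avg (grads F (rep x)) - avg (grads F (rep y))) \<le> L * norm (x - y)" for x y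
  proof -
    have "real CARD('n) * (norm (avg (grads F (rep x)) - avg (grads F (rep y))))\<^sup>2
        \<le> L\<^sup>2 * (norm (rep (x - y) :: real^'d^'n))\<^sup>2"
      using avg_grads_diff_le[of "rep x" "rep y"] by simp
    also have "\<dots> = real CARD('n) * (L * norm (x - y))\<^sup>2"
      unfolding norm_rep_power2 by (simp add: power_mult_distrib)
    finally have "(norm (avg (grads F (rep x)) - avg (grads F (rep y))))\<^sup>2 \<le> (L * norm (x - y))\<^sup>2"
      by simp
    then show ?thesis
      by (rule power2_le_imp_le) (use L in auto)
  qed
  from descent_lemma[OF GDERIV_avg this, of x h] show ?thesis
    by (simp add: gradient_avg)
qed

text \<open>Polarization of the inner product in the descent lemma produces both negative squares.
  The price is the distance of \<open>avg Y\<close> from the true gradient, which the tracking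
  hypothesis turns into the disagreement of \<open>X\<close>.\<close>

lemma cost_step:
  assumes "avg Y = avg (grads F X)"
  shows "real CARD('n) * (avg_cost F (avg X - \<eta> *\<^sub>R avg Y) - Fstar)
    \<le> real CARD('n) * (avg_cost F (avg X) - Fstar)
      - \<eta> / 2 * (real CARD('n) * (norm (gradient (avg_cost F) (avg X)))\<^sup>2)
      - (\<eta> / 2 - L * \<eta>\<^sup>2 / 2) * (real CARD('n) * (norm (avg Y))\<^sup>2)
      + \<eta> / 2 * L\<^sup>2 * (norm (X - rep (avg X)))\<^sup>2"
proof -
  define gr where "gr = gradient (avg_cost F) (avg X)"
  define y where "y = avg Y"
  define N where "N = real CARD('n)"
  have "N * (norm (gr - y))\<^sup>2 \<le> L\<^sup>2 * (norm (X - rep (avg X)))\<^sup>2"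
    using avg_grads_diff_le[of "rep (avg X)" X] assms
    by (simp add: gr_def y_def N_def gradient_avg norm_minus_commute)
  from mult_left_mono[OF this, of "\<eta> / 2"]
  have 1: "\<eta> / 2 * (N * (norm (gr - y))\<^sup>2) \<le> \<eta> / 2 * L\<^sup>2 * (norm (X - rep (avg X)))\<^sup>2"
    using h by simp
  have "avg_cost F (avg X - \<eta> *\<^sub>R y) \<le> avg_cost F (avg X) - \<eta> * (gr \<bullet> y) + L / 2 * (\<eta>\<^sup>2 * (norm y)\<^sup>2)"
    using avg_cost_descent[of "avg X" "- \<eta> *\<^sub>R y"] by (simp add: gr_def power_mult_distrib)
  also have "gr \<bullet> y = ((norm gr)\<^sup>2 + (norm y)\<^sup>2 - (norm (gr - y))\<^sup>2) / 2"
    by (simp add: power2_norm_eq_inner inner_diff_left inner_diff_right inner_commute)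
  finally have "N * avg_cost F (avg X - \<eta> *\<^sub>R y) \<le> N * (avg_cost F (avg X)
      - \<eta> * (((norm gr)\<^sup>2 + (norm y)\<^sup>2 - (norm (gr - y))\<^sup>2) / 2) + L / 2 * (\<eta>\<^sup>2 * (norm y)\<^sup>2))"
    by (intro mult_left_mono) (auto simp: N_def)
  also have "\<dots> = N * avg_cost F (avg X) - \<eta> / 2 * (N * (norm gr)\<^sup>2)
      - (\<eta> / 2 - L * \<eta>\<^sup>2 / 2) * (N * (norm y)\<^sup>2) + \<eta> / 2 * (N * (norm (gr - y))\<^sup>2)"
    by (simp add: field_simps)
  finally show ?thesis
    using 1 unfolding gr_def[symmetric] y_def[symmetric] N_def[symmetric] right_diff_distrib
    by linarith
qed

text \<open>Total coefficient of the excess: one part from \<open>tracking_step\<close>, the other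
  from \<open>compression_error\<close>, weighted as in \<open>lyapunov_arith\<close>. Only its sign
  matters later, because the excess has nonpositive mean.\<close>

definition excess_weight_X :: real where
  "excess_weight_X = (1 + c1) * \<phi>X * r + 8.3 * \<gamma> * (2 * r\<^sup>2)"

definition excess_weight_Y :: real where
  "excess_weight_Y = (1 - \<sigma>) * ((1 + c2) * \<phi>Y * r) + 8.2 * \<phi> * \<gamma> * (2 * r\<^sup>2)"

lemma excess_weight_nonneg: "0 \<le> excess_weight_X" "0 \<le> excess_weight_Y"
  using c1 c2 phiX phiY r g q phi_pos by (auto simp: excess_weight_X_def excess_weight_Y_def)

text \<open>Transfers \<open>lyapunov_arith\<close> to the vectors. \<open>QX\<close> and
  \<open>QY\<close> are arbitrary here, so the inequality holds for every outcome of the compressor.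
  \<open>B\<close> stands for the reference of \<open>Y\<close>, called C in the algorithm.\<close>

lemma potential_descent:
  fixes X Y A B QX QY X' Y' :: "real^'d^'n"
  assumes avgY: "avg Y = avg (grads F X)"
    and X': "X' = X - \<gamma> *\<^sub>R (A - mix W A + QX - mix W QX) - \<eta> *\<^sub>R Y"
    and Y': "Y' = Y - \<gamma> *\<^sub>R (B - mix W B + QY - mix W QY) + grads F X' - grads F X"
  shows "potential (1 - \<sigma>) F Fstar \<phi> X' Y' (A + \<phi>X *\<^sub>R QX) (B + \<phi>Y *\<^sub>R QY)
    \<le> (1 - 0.9 * \<gamma> * (1 - \<sigma>)) * (norm (X - rep (avg X)))\<^sup>2
      + (1 - 0.7 * \<gamma> * (1 - \<sigma>)) * (\<phi> * (norm (Y - rep (avg Y)))\<^sup>2)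
      + (1 - 0.7 * c1) * (norm (X - A))\<^sup>2 + (1 - 0.9 * c2) * ((1 - \<sigma>) * (norm (Y - B))\<^sup>2)
      + real CARD('n) * (avg_cost F (avg X) - Fstar)
      - \<eta> / 2 * (real CARD('n) * (norm (gradient (avg_cost F) (avg X)))\<^sup>2)
      + excess_weight_X * compression_excess r \<psi> (X - A) QX
      + excess_weight_Y * compression_excess r \<psi> (Y - B) QY"
proof -
  have s: "0 \<le> \<sigma>" "\<sigma> < 1"
    using q by (simp_all add: sigma spectral_norm_def onorm_pos_le matrix_vector_mul_bounded_linear)
  define PY where "PY = grads F X' - grads F X"
  have X'': "X' = X - \<gamma> *\<^sub>R (A - mix W A + QX - mix W QX) + - \<eta> *\<^sub>R Y"
    and Y'': "Y' = Y - \<gamma> *\<^sub>R (B - mix W B + QY - mix W QY) + PY"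
    using X' Y' by (simp_all add: PY_def)
  note SX = mixing_step[OF col row sigma s g gamma_le X'']
    and SY = mixing_step[OF col row sigma s g gamma_le Y'']
  have PX: "- \<eta> *\<^sub>R Y - rep (avg (- \<eta> *\<^sub>R Y)) = - \<eta> *\<^sub>R (Y - rep (avg Y))"
    by (simp add: algebra_simps)
  have PY: "(norm PY)\<^sup>2 \<le> L\<^sup>2 * (norm (X' - X))\<^sup>2"
    unfolding PY_def by (rule norm_grads_diff_le)
  have PYd: "(norm (PY - rep (avg PY)))\<^sup>2 \<le> (norm PY)\<^sup>2"
    by (intro power_mono norm_deviation_le) auto
  let ?zx = "(norm (X - A))\<^sup>2" and ?zy = "(norm (Y - B))\<^sup>2" and ?w = "(norm (X' - X))\<^sup>2"
  let ?\<tau>x = "compression_excess r \<psi> (X - A) QX" and ?\<tau>y = "compression_excess r \<psi> (Y - B) QY"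
  let ?ex = "(norm (X - A - QX))\<^sup>2" and ?ey = "(norm (Y - B - QY))\<^sup>2"
  let ?gy = "real CARD('n) * (norm (avg Y))\<^sup>2"
  let ?x2 = "(norm (X - rep (avg X)))\<^sup>2" and ?y2 = "(norm (Y - rep (avg Y)))\<^sup>2"
  let ?Dx = "(X - rep (avg X)) \<bullet> (X - mix W X)" and ?Dy = "(Y - rep (avg Y)) \<bullet> (Y - mix W Y)"
  have x2': "(norm (X' - rep (avg X')))\<^sup>2
      \<le> ?x2 - 1.2 * \<gamma> * ?Dx + 8.1 * \<gamma> * ?ex + 2.1 / (\<gamma> * (1 - \<sigma>)) * (\<eta>\<^sup>2 * ?y2)"
    using SX(2) unfolding PX by (simp add: power_mult_distrib)
  have "2.1 / (\<gamma> * (1 - \<sigma>)) * (norm (PY - rep (avg PY)))\<^sup>2 \<le> 2.1 / (\<gamma> * (1 - \<sigma>)) * (L\<^sup>2 * ?w)"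
    using order_trans[OF PYd PY] g q by (intro mult_left_mono) auto
  with SY(2) have y2': "(norm (Y' - rep (avg Y')))\<^sup>2
      \<le> ?y2 - 1.2 * \<gamma> * ?Dy + 8.1 * \<gamma> * ?ey + 2.1 / (\<gamma> * (1 - \<sigma>)) * (L\<^sup>2 * ?w)"
    by linarith
  have w: "?w \<le> 6 * \<gamma>\<^sup>2 * ?Dx + 12 * \<gamma>\<^sup>2 * ?ex + 3 * (\<eta>\<^sup>2 * (?y2 + ?gy))"
    using SX(3) norm_decomp[of Y] by (simp add: power_mult_distrib norm_rep_power2)
  have v: "(norm (Y' - Y))\<^sup>2 \<le> 6 * \<gamma>\<^sup>2 * ?Dy + 12 * \<gamma>\<^sup>2 * ?ey + 3 * (L\<^sup>2 * ?w)"
    using SY(3) PY by linarith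
  have zx': "(norm (X' - (A + \<phi>X *\<^sub>R QX)))\<^sup>2 \<le> (1 - c1) * ?zx + (1 + c1) * \<phi>X * r * ?\<tau>x + (1 + 1 / c1) * ?w"
    by (rule tracking_step[OF r phiX c1_eq c1])
  have zy': "(norm (Y' - (B + \<phi>Y *\<^sub>R QY)))\<^sup>2
      \<le> (1 - c2) * ?zy + (1 + c2) * \<phi>Y * r * ?\<tau>y + (1 + 1 / c2) * (norm (Y' - Y))\<^sup>2"
    by (rule tracking_step[OF r phiY c2_eq c2])
  have ex: "?ex \<le> C * ?zx + 2 * r\<^sup>2 * ?\<tau>x" and ey: "?ey \<le> C * ?zy + 2 * r\<^sup>2 * ?\<tau>y"
    unfolding C_eq by (rule compression_error[OF r])+
  have f': "real CARD('n) * (avg_cost F (avg X') - Fstar) \<le> real CARD('n) * (avg_cost F (avg X) - Fstar)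
      - \<eta> / 2 * (real CARD('n) * (norm (gradient (avg_cost F) (avg X)))\<^sup>2)
      - (\<eta> / 2 - L * \<eta>\<^sup>2 / 2) * ?gy + \<eta> / 2 * L\<^sup>2 * ?x2"
    using cost_step[OF avgY] SX(1) by simp
  show ?thesis
    unfolding potential_def excess_weight_X_def excess_weight_Y_def
    by (rule order_trans[OF _ lyapunov_arith[OF _ _ _ _ _ _ _ _ SX(4) SY(4) x2' y2' w v zx' zy' ex ey f']])
      simp_all
qed

text \<open>Laplacian terms have average 0 because the columns of \<open>W\<close> sum to 1, so
  compression errors never reach the average of \<open>Y\<close> and only the gradient difference
  remains.\<close>

lemma avg_tracking:
  assumes "avg Y = avg (grads F X)"
    and "Y' = Y - \<gamma> *\<^sub>R (B - mix W B + QY - mix W QY) + grads F X' - grads F X"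
  shows "avg Y' = avg (grads F X')"
  using assms by (simp add: avg_mix[OF col])

end

section \<open>Measurability and independence\<close>

lemma borel_measurable_vec_lambda:
  fixes f :: "'n::finite \<Rightarrow> 'w \<Rightarrow> 'a::euclidean_space"
  assumes "\<And>i. f i \<in> borel_measurable N"
  shows "(\<lambda>\<omega>. \<chi> i. f i \<omega>) \<in> borel_measurable N"
proof (subst borel_measurable_euclidean_space, rule ballI)
  fix b :: "'a^'n" assume "b \<in> Basis"
  then obtain i u where b: "b = axis i u"
    by (auto simp: Basis_vec_def)
  have "(\<lambda>\<omega>. f i \<omega> \<bullet> u) \<in> borel_measurable N"
    using assms by (intro borel_measurable_inner) auto
  then show "(\<lambda>\<omega>. (\<chi> i. f i \<omega>) \<bullet> b) \<in> borel_measurable N"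
    by (simp add: b inner_axis)
qed

lemma borel_measurable_vec_nth [measurable (raw)]:
  fixes f :: "'w \<Rightarrow> 'a::euclidean_space^'n::finite"
  assumes "f \<in> borel_measurable N"
  shows "(\<lambda>\<omega>. f \<omega> $ i) \<in> borel_measurable N"
  by (rule measurable_compose[OF assms borel_measurable_continuous_onI])
    (intro continuous_intros)

lemma borel_measurable_mix [measurable (raw)]:
  fixes f :: "'w \<Rightarrow> real^'d::finite^'n::finite"
  assumes [measurable]: "f \<in> borel_measurable N"
  shows "(\<lambda>\<omega>. mix W (f \<omega>)) \<in> borel_measurable N"
  unfolding mix_def by (intro borel_measurable_vec_lambda) measurable

lemma borel_measurable_avg [measurable (raw)]:
  fixes f :: "'w \<Rightarrow> real^'d::finite^'n::finite"
  assumes [measurable]: "f \<in> borel_measurable N"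
  shows "(\<lambda>\<omega>. avg (f \<omega>)) \<in> borel_measurable N"
  unfolding avg_def by measurable

lemma borel_measurable_rep [measurable (raw)]:
  fixes f :: "'w \<Rightarrow> real^'d::finite"
  assumes [measurable]: "f \<in> borel_measurable N"
  shows "(\<lambda>\<omega>. rep (f \<omega>) :: real^'d^'n::finite) \<in> borel_measurable N"
  unfolding rep_def by (intro borel_measurable_vec_lambda) measurable

section \<open>The algorithm as a function of its seeds\<close>

lemma algorithm_invariants:
  fixes W :: "real^'n::finite^'n" and F :: "'n \<Rightarrow> real^'d::finite \<Rightarrow> real"
    and compr :: "'r \<Rightarrow> real^'d \<Rightarrow> real^'d" and \<gamma> \<eta> \<phi>X \<phi>Y :: real
    and sd :: "channel \<Rightarrow> nat \<Rightarrow> 'n \<Rightarrow> 'r" and X0 :: "real^'d^'n"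
  defines "s \<equiv> \<lambda>k. algorithm W F \<gamma> \<eta> \<phi>X \<phi>Y compr X0 sd k"
  shows "stB (s k) = stA (s k) - mix W (stA (s k))"
    and "stD (s k) = stC (s k) - mix W (stC (s k))"
    and "stQX (s k) = (\<chi> i. compr (sd ChanX k i) ((stX (s k) - stA (s k)) $ i))"
    and "stQY (s k) = (\<chi> i. compr (sd ChanY k i) ((stY (s k) - stC (s k)) $ i))"
proof -
  have "stB (s k) = stA (s k) - mix W (stA (s k)) \<and> stD (s k) = stC (s k) - mix W (stC (s k))"
    by (induction k) (simp_all add: s_def alg_init_def alg_step_def Let_def mix_simps algebra_simps)
  then show "stB (s k) = stA (s k) - mix W (stA (s k))" "stD (s k) = stC (s k) - mix W (stC (s k))"
    by simp_all
  \<comment> \<open>At time 0 this agrees with the initialization because \<open>A\<close> and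
    \<open>C\<close> start at 0.\<close>
  show "stQX (s k) = (\<chi> i. compr (sd ChanX k i) ((stX (s k) - stA (s k)) $ i))"
    "stQY (s k) = (\<chi> i. compr (sd ChanY k i) ((stY (s k) - stC (s k)) $ i))"
    by (cases k; simp add: s_def alg_init_def alg_step_def Let_def)+
qed

text \<open>The off-by-one behind independence: the full state at time \<open>k\<close> contains the
  compressed messages and so reads the seeds of time \<open>k\<close>, but its other components read
  earlier seeds only. Hence full states are compared for \<open>m < k\<close> and one step is
  added.\<close>

lemma algorithm_past:
  fixes W :: "real^'n::finite^'n" and F :: "'n \<Rightarrow> real^'d::finite \<Rightarrow> real"
    and compr :: "'r \<Rightarrow> real^'d \<Rightarrow> real^'d" and \<gamma> \<eta> \<phi>X \<phi>Y :: real
    and sd sd' :: "channel \<Rightarrow> nat \<Rightarrow> 'n \<Rightarrow> 'r" and X0 :: "real^'d^'n"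
  assumes "\<And>c j i. j < k \<Longrightarrow> sd c j i = sd' c j i"
  defines "s \<equiv> algorithm W F \<gamma> \<eta> \<phi>X \<phi>Y compr X0 sd k"
    and "s' \<equiv> algorithm W F \<gamma> \<eta> \<phi>X \<phi>Y compr X0 sd' k"
  shows "stX s = stX s'" "stY s = stY s'" "stA s = stA s'" "stC s = stC s'"
proof -
  have full: "algorithm W F \<gamma> \<eta> \<phi>X \<phi>Y compr X0 sd m = algorithm W F \<gamma> \<eta> \<phi>X \<phi>Y compr X0 sd' m"
    if "m < k" for m
    using that by (induction m) (simp_all add: assms(1))
  show "stX s = stX s'" "stY s = stY s'" "stA s = stA s'" "stC s = stC s'"
    by (cases k; simp add: s_def s'_def alg_init_def alg_step_def Let_def full)+
qed

text \<open>Stated for an arbitrary space \<open>N\<close> and arbitrary seed maps, since it is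
  applied both to the original probability space and to the product space of past seeds.\<close>

lemma algorithm_measurable:
  fixes W :: "real^'n::finite^'n" and F :: "'n \<Rightarrow> real^'d::finite \<Rightarrow> real"
    and compr :: "'r \<Rightarrow> real^'d \<Rightarrow> real^'d" and \<gamma> \<eta> \<phi>X \<phi>Y :: real
    and sd :: "channel \<Rightarrow> nat \<Rightarrow> 'n \<Rightarrow> 'w \<Rightarrow> 'r" and X0 :: "real^'d^'n"
  assumes sd: "\<And>c j i. sd c j i \<in> N \<rightarrow>\<^sub>M R"
    and compr: "case_prod compr \<in> borel_measurable (R \<Otimes>\<^sub>M borel)"
    and grads: "grads F \<in> borel_measurable borel"
  defines "s \<equiv> \<lambda>k \<omega>. algorithm W F \<gamma> \<eta> \<phi>X \<phi>Y compr X0 (\<lambda>c j i. sd c j i \<omega>) k"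
  shows "(\<lambda>\<omega>. stX (s k \<omega>)) \<in> borel_measurable N" "(\<lambda>\<omega>. stY (s k \<omega>)) \<in> borel_measurable N"
    "(\<lambda>\<omega>. stA (s k \<omega>)) \<in> borel_measurable N" "(\<lambda>\<omega>. stC (s k \<omega>)) \<in> borel_measurable N"
    "(\<lambda>\<omega>. stQX (s k \<omega>)) \<in> borel_measurable N" "(\<lambda>\<omega>. stQY (s k \<omega>)) \<in> borel_measurable N"
proof -
  have c: "(\<lambda>\<omega>. \<chi> i. compr (sd c j i \<omega>) (Z \<omega> $ i)) \<in> borel_measurable N"
    if [measurable]: "Z \<in> borel_measurable N" for Z :: "'w \<Rightarrow> real^'d^'n" and c j
  proof (rule borel_measurable_vec_lambda)
    fix i
    have "(\<lambda>\<omega>. (sd c j i \<omega>, Z \<omega> $ i)) \<in> N \<rightarrow>\<^sub>M R \<Otimes>\<^sub>M borel"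
      by (intro measurable_Pair sd) measurable
    from measurable_compose[OF this compr]
    show "(\<lambda>\<omega>. compr (sd c j i \<omega>) (Z \<omega> $ i)) \<in> borel_measurable N"
      by simp
  qed
  note inv = algorithm_invariants[of W F \<gamma> \<eta> \<phi>X \<phi>Y compr X0]
  have Q: "(\<lambda>\<omega>. stQX (s k \<omega>)) \<in> borel_measurable N \<and> (\<lambda>\<omega>. stQY (s k \<omega>)) \<in> borel_measurable N"
    if "(\<lambda>\<omega>. stX (s k \<omega>)) \<in> borel_measurable N \<and> (\<lambda>\<omega>. stY (s k \<omega>)) \<in> borel_measurable N \<and>
     (\<lambda>\<omega>. stA (s k \<omega>)) \<in> borel_measurable N \<and> (\<lambda>\<omega>. stC (s k \<omega>)) \<in> borel_measurable N" for k
  proof -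
    have "(\<lambda>\<omega>. stX (s k \<omega>) - stA (s k \<omega>)) \<in> borel_measurable N"
      "(\<lambda>\<omega>. stY (s k \<omega>) - stC (s k \<omega>)) \<in> borel_measurable N"
      using that by auto
    from c[OF this(1), of ChanX k] c[OF this(2), of ChanY k] show ?thesis
      by (simp add: s_def inv(3,4))
  qed
  have main: "(\<lambda>\<omega>. stX (s k \<omega>)) \<in> borel_measurable N \<and> (\<lambda>\<omega>. stY (s k \<omega>)) \<in> borel_measurable N \<and>
     (\<lambda>\<omega>. stA (s k \<omega>)) \<in> borel_measurable N \<and> (\<lambda>\<omega>. stC (s k \<omega>)) \<in> borel_measurable N" for k
  proof (induction k)
    case 0
    then show ?case by (simp add: s_def alg_init_def)
  next
    case (Suc k)
    note Q[OF Suc]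
    with Suc have [measurable]: "(\<lambda>\<omega>. stX (s k \<omega>)) \<in> borel_measurable N" "(\<lambda>\<omega>. stY (s k \<omega>)) \<in> borel_measurable N"
      "(\<lambda>\<omega>. stA (s k \<omega>)) \<in> borel_measurable N" "(\<lambda>\<omega>. stC (s k \<omega>)) \<in> borel_measurable N"
      "(\<lambda>\<omega>. stQX (s k \<omega>)) \<in> borel_measurable N" "(\<lambda>\<omega>. stQY (s k \<omega>)) \<in> borel_measurable N"
      by auto
    have B: "stB (s k \<omega>) = stA (s k \<omega>) - mix W (stA (s k \<omega>))"
      and D: "stD (s k \<omega>) = stC (s k \<omega>) - mix W (stC (s k \<omega>))" for \<omega>
      unfolding s_def by (rule inv)+
    have step: "s (Suc k) \<omega> = alg_step W F \<gamma> \<eta> \<phi>X \<phi>Y (\<lambda>i. compr (sd ChanX (Suc k) i \<omega>))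
      (\<lambda>i. compr (sd ChanY (Suc k) i \<omega>)) (s k \<omega>)" for \<omega>
      by (simp add: s_def)
    have X: "(\<lambda>\<omega>. stX (s (Suc k) \<omega>)) \<in> borel_measurable N"
      unfolding step by (simp add: alg_step_def Let_def B)
    have gr: "(\<lambda>\<omega>. grads F (stX (s m \<omega>))) \<in> borel_measurable N"
      if "(\<lambda>\<omega>. stX (s m \<omega>)) \<in> borel_measurable N" for m
      using measurable_compose[OF that grads] .
    note [measurable] = gr[OF X] gr[of k]
    have "stY (s (Suc k) \<omega>) = stY (s k \<omega>) - \<gamma> *\<^sub>R (stD (s k \<omega>) + stQY (s k \<omega>) - mix W (stQY (s k \<omega>)))
      + grads F (stX (s (Suc k) \<omega>)) - grads F (stX (s k \<omega>))" for \<omega>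
      unfolding step by (simp add: alg_step_def Let_def)
    then have "(\<lambda>\<omega>. stY (s (Suc k) \<omega>)) \<in> borel_measurable N"
      by (simp add: D)
    moreover have "(\<lambda>\<omega>. stA (s (Suc k) \<omega>)) \<in> borel_measurable N" "(\<lambda>\<omega>. stC (s (Suc k) \<omega>)) \<in> borel_measurable N"
      unfolding step by (simp_all add: alg_step_def Let_def)
    ultimately show ?case using X by simp
  qed
  from main[of k] Q[OF main, of k]
  show "(\<lambda>\<omega>. stX (s k \<omega>)) \<in> borel_measurable N" "(\<lambda>\<omega>. stY (s k \<omega>)) \<in> borel_measurable N"
    "(\<lambda>\<omega>. stA (s k \<omega>)) \<in> borel_measurable N" "(\<lambda>\<omega>. stC (s k \<omega>)) \<in> borel_measurable N"
    "(\<lambda>\<omega>. stQX (s k \<omega>)) \<in> borel_measurable N" "(\<lambda>\<omega>. stQY (s k \<omega>)) \<in> borel_measurable N"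
    by auto
qed

section \<open>Independence and the mean of the compression excess\<close>

lemma (in prob_space) indep_var_pair_distr:
  assumes indep: "indep_var S X T Y" and f: "f \<in> S \<rightarrow>\<^sub>M S'" and g: "g \<in> T \<rightarrow>\<^sub>M T'"
  shows "distr M S' (\<lambda>\<omega>. f (X \<omega>)) \<Otimes>\<^sub>M distr M T' (\<lambda>\<omega>. g (Y \<omega>))
    = distr M (S' \<Otimes>\<^sub>M T') (\<lambda>\<omega>. (f (X \<omega>), g (Y \<omega>)))"
proof -
  have X [measurable]: "X \<in> M \<rightarrow>\<^sub>M S" and Y [measurable]: "Y \<in> M \<rightarrow>\<^sub>M T"
    and joint: "distr M S X \<Otimes>\<^sub>M distr M T Y = distr M (S \<Otimes>\<^sub>M T) (\<lambda>\<omega>. (X \<omega>, Y \<omega>))"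
    using indep unfolding indep_var_distribution_eq by auto
  note [measurable] = f g
  interpret gY: prob_space "distr M T' (\<lambda>\<omega>. g (Y \<omega>))" by (rule prob_space_distr) measurable
  have gY: "distr (distr M T Y) T' g = distr M T' (\<lambda>\<omega>. g (Y \<omega>))"
    and fX: "distr (distr M S X) S' f = distr M S' (\<lambda>\<omega>. f (X \<omega>))"
    using distr_distr[OF g Y] distr_distr[OF f X] by (simp_all add: comp_def)
  have "sigma_finite_measure (distr (distr M T Y) T' g)"
    unfolding gY by unfold_locales
  then have "distr (distr M S X) S' f \<Otimes>\<^sub>M distr (distr M T Y) T' g
      = distr (distr M S X \<Otimes>\<^sub>M distr M T Y) (S' \<Otimes>\<^sub>M T') (\<lambda>(x, y). (f x, g y))"
    by (intro pair_measure_distr) (use f g in simp_all)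
  also have "\<dots> = distr M (S' \<Otimes>\<^sub>M T') (\<lambda>\<omega>. (f (X \<omega>), g (Y \<omega>)))"
    unfolding joint by (subst distr_distr) (measurable, simp add: comp_def)
  finally show ?thesis
    unfolding gY fX .
qed

text \<open>Because the joint law of seed and input is a product, Fubini integrates over the seed
  first with the input frozen, where the compressor hypothesis applies. Nonnegative integrals are
  used because integrability of the compression error is only a consequence.\<close>

lemma (in prob_space) compression_nn_expectation:
  fixes compr :: "'r \<Rightarrow> 'b::euclidean_space \<Rightarrow> 'b" and s :: "'a \<Rightarrow> 'r" and Z :: "'a \<Rightarrow> 'b"
  assumes R: "prob_space R"
    and compr: "case_prod compr \<in> borel_measurable (R \<Otimes>\<^sub>M borel)"
    and int: "\<And>x. integrable R (\<lambda>s. (norm ((1 / r) *\<^sub>R compr s x - x))\<^sup>2)"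
    and le: "\<And>x. (\<integral>s. (norm ((1 / r) *\<^sub>R compr s x - x))\<^sup>2 \<partial>R) \<le> (1 - \<psi>) * (norm x)\<^sup>2"
    and distr: "distr M R s = R"
    and s [measurable]: "s \<in> M \<rightarrow>\<^sub>M R" and Z [measurable]: "Z \<in> borel_measurable M"
    and joint: "distr M R s \<Otimes>\<^sub>M distr M borel Z = distr M (R \<Otimes>\<^sub>M borel) (\<lambda>\<omega>. (s \<omega>, Z \<omega>))"
  shows "(\<integral>\<^sup>+\<omega>. ennreal ((norm ((1 / r) *\<^sub>R compr (s \<omega>) (Z \<omega>) - Z \<omega>))\<^sup>2) \<partial>M)
      \<le> (\<integral>\<^sup>+\<omega>. ennreal ((1 - \<psi>) * (norm (Z \<omega>))\<^sup>2) \<partial>M)"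
proof -
  define f where "f = (\<lambda>(a, x). ennreal ((norm ((1 / r) *\<^sub>R compr a x - x))\<^sup>2))"
  note [measurable] = compr[unfolded case_prod_beta']
  have f: "f \<in> borel_measurable (R \<Otimes>\<^sub>M borel)"
    unfolding f_def case_prod_beta' by measurable
  interpret R: prob_space R by (rule R)
  interpret Z: prob_space "distr M borel Z" by (rule prob_space_distr) simp
  interpret P: pair_sigma_finite R "distr M borel Z" ..
  have "(\<integral>\<^sup>+\<omega>. ennreal ((norm ((1 / r) *\<^sub>R compr (s \<omega>) (Z \<omega>) - Z \<omega>))\<^sup>2) \<partial>M)
      = (\<integral>\<^sup>+\<omega>. f (s \<omega>, Z \<omega>) \<partial>M)"
    by (simp add: f_def)
  also have "\<dots> = (\<integral>\<^sup>+p. f p \<partial>(R \<Otimes>\<^sub>M distr M borel Z))"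
    using joint f unfolding distr by (simp add: nn_integral_distr)
  also have "\<dots> = (\<integral>\<^sup>+x. (\<integral>\<^sup>+a. f (a, x) \<partial>R) \<partial>distr M borel Z)"
    using f by (intro P.nn_integral_snd[symmetric]) simp
  also have "\<dots> \<le> (\<integral>\<^sup>+x. ennreal ((1 - \<psi>) * (norm x)\<^sup>2) \<partial>distr M borel Z)"
    by (intro nn_integral_mono) (simp add: f_def nn_integral_eq_integral[OF int] le ennreal_leI)
  also have "\<dots> = (\<integral>\<^sup>+\<omega>. ennreal ((1 - \<psi>) * (norm (Z \<omega>))\<^sup>2) \<partial>M)"
    by (simp add: nn_integral_distr)
  finally show ?thesis .
qed

text \<open>The squared norm is a sum over agents, so the joint law of each seed with its own block
  is enough.\<close>

lemma (in prob_space) compression_excess_expectation: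
  fixes compr :: "'r \<Rightarrow> real^'d::finite \<Rightarrow> real^'d" and Z :: "'a \<Rightarrow> real^'d^'n::finite"
  assumes R: "prob_space R"
    and compr: "case_prod compr \<in> borel_measurable (R \<Otimes>\<^sub>M borel)"
    and int: "\<And>x. integrable R (\<lambda>s. (norm ((1 / r) *\<^sub>R compr s x - x))\<^sup>2)"
    and le: "\<And>x. (\<integral>s. (norm ((1 / r) *\<^sub>R compr s x - x))\<^sup>2 \<partial>R) \<le> (1 - \<psi>) * (norm x)\<^sup>2"
    and psi: "\<psi> \<le> 1"
    and distr: "\<And>i. distr M R (s i) = R"
    and s: "\<And>i. s i \<in> M \<rightarrow>\<^sub>M R"
    and joint: "\<And>i. distr M R (s i) \<Otimes>\<^sub>M distr M borel (\<lambda>\<omega>. Z \<omega> $ i)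
      = distr M (R \<Otimes>\<^sub>M borel) (\<lambda>\<omega>. (s i \<omega>, Z \<omega> $ i))"
    and Q: "\<And>\<omega>. Q \<omega> = (\<chi> i. compr (s i \<omega>) (Z \<omega> $ i))"
    and meas: "Q \<in> borel_measurable M" "Z \<in> borel_measurable M"
    and Zint: "integrable M (\<lambda>\<omega>. (norm (Z \<omega>))\<^sup>2)"
  shows "integrable M (\<lambda>\<omega>. compression_excess r \<psi> (Z \<omega>) (Q \<omega>))"
    and "(\<integral>\<omega>. compression_excess r \<psi> (Z \<omega>) (Q \<omega>) \<partial>M) \<le> 0"
proof -
  note [measurable] = meas
  define T where "T \<omega> = (norm ((1 / r) *\<^sub>R Q \<omega> - Z \<omega>))\<^sup>2" for \<omega>
  have T_nonneg: "0 \<le> T \<omega>" for \<omega>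
    by (simp add: T_def)
  have [measurable]: "T \<in> borel_measurable M"
    unfolding T_def by measurable
  have cm: "(\<lambda>\<omega>. compr (s i \<omega>) (Z \<omega> $ i)) \<in> borel_measurable M" for i
  proof -
    have "(\<lambda>\<omega>. Q \<omega> $ i) \<in> borel_measurable M" by measurable
    then show ?thesis by (simp add: Q)
  qed
  note [measurable] = cm
  have "(\<integral>\<^sup>+\<omega>. ennreal (T \<omega>) \<partial>M)
      = (\<integral>\<^sup>+\<omega>. (\<Sum>i\<in>UNIV. ennreal ((norm ((1 / r) *\<^sub>R compr (s i \<omega>) (Z \<omega> $ i) - Z \<omega> $ i))\<^sup>2)) \<partial>M)"
    by (simp add: T_def norm_vec_power2[where 'n='n] Q flip: sum_ennreal)
  also have "\<dots> = (\<Sum>i\<in>UNIV. \<integral>\<^sup>+\<omega>. ennreal ((norm ((1 / r) *\<^sub>R compr (s i \<omega>) (Z \<omega> $ i) - Z \<omega> $ i))\<^sup>2) \<partial>M)"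
    by (intro nn_integral_sum) measurable
  also have "\<dots> \<le> (\<Sum>i\<in>UNIV. \<integral>\<^sup>+\<omega>. ennreal ((1 - \<psi>) * (norm (Z \<omega> $ i))\<^sup>2) \<partial>M)"
    by (intro sum_mono compression_nn_expectation[OF R compr int le distr s _ joint])
      measurable
  also have "\<dots> = (\<integral>\<^sup>+\<omega>. (\<Sum>i\<in>UNIV. ennreal ((1 - \<psi>) * (norm (Z \<omega> $ i))\<^sup>2)) \<partial>M)"
    by (intro nn_integral_sum[symmetric]) measurable
  also have "\<dots> = (\<integral>\<^sup>+\<omega>. ennreal ((1 - \<psi>) * (norm (Z \<omega>))\<^sup>2) \<partial>M)"
    using psi by (simp add: norm_vec_power2[where 'n='n] sum_distrib_left)
  also have "\<dots> = ennreal (\<integral>\<omega>. (1 - \<psi>) * (norm (Z \<omega>))\<^sup>2 \<partial>M)"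
    using psi Zint by (intro nn_integral_eq_integral) auto
  finally have nn: "(\<integral>\<^sup>+\<omega>. ennreal (T \<omega>) \<partial>M) \<le> ennreal (\<integral>\<omega>. (1 - \<psi>) * (norm (Z \<omega>))\<^sup>2 \<partial>M)" .
  have Tint: "integrable M T"
    using nn by (intro integrableI_nonneg) (auto simp: T_def top_unique less_top[symmetric])
  show "integrable M (\<lambda>\<omega>. compression_excess r \<psi> (Z \<omega>) (Q \<omega>))"
    using Tint Zint unfolding compression_excess_def T_def by auto
  have "(\<integral>\<omega>. T \<omega> \<partial>M) \<le> (\<integral>\<omega>. (1 - \<psi>) * (norm (Z \<omega>))\<^sup>2 \<partial>M)"
    using nn psi T_nonneg by (subst (asm) nn_integral_eq_integral[OF Tint]) (auto simp: ennreal_le_iff)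
  then show "(\<integral>\<omega>. compression_excess r \<psi> (Z \<omega>) (Q \<omega>) \<partial>M) \<le> 0"
    using Tint Zint unfolding compression_excess_def T_def[symmetric] by simp
qed

section \<open>Expectations along the algorithm\<close>

locale stochastic_tracking =
  compressed_tracking \<sigma> L \<gamma> \<eta> c1 c2 C \<phi> W F r \<psi> \<phi>X \<phi>Y Fstar + prob_space M
  for \<sigma> L \<gamma> \<eta> c1 c2 C \<phi> :: real and W :: "real^'n::finite^'n"
    and F :: "'n \<Rightarrow> real^'d::finite \<Rightarrow> real" and r \<psi> \<phi>X \<phi>Y Fstar :: real and M :: "'w measure" +
  fixes R :: "'r measure" and compr :: "'r \<Rightarrow> real^'d \<Rightarrow> real^'d"
    and seed :: "channel \<Rightarrow> nat \<Rightarrow> 'n \<Rightarrow> 'w \<Rightarrow> 'r" and X0 :: "real^'d^'n"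
  assumes R: "prob_space R"
    and comp_meas: "case_prod compr \<in> borel_measurable (R \<Otimes>\<^sub>M borel)"
    and psi: "\<psi> \<le> 1"
    and contract_integrable: "\<And>x. integrable R (\<lambda>s. (norm ((1 / r) *\<^sub>R compr s x - x))\<^sup>2)"
    and contract: "\<And>x. (\<integral>s. (norm ((1 / r) *\<^sub>R compr s x - x))\<^sup>2 \<partial>R) \<le> (1 - \<psi>) * (norm x)\<^sup>2"
    and seed_indep: "indep_vars (\<lambda>_. R) (\<lambda>(c, k, i). seed c k i) UNIV"
    and seed_distr: "\<And>c k i. distr M R (seed c k i) = R"
begin

abbreviation alg :: "(channel \<Rightarrow> nat \<Rightarrow> 'n \<Rightarrow> 'r) \<Rightarrow> nat \<Rightarrow> ('d, 'n) alg_state" where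
  "alg \<equiv> algorithm W F \<gamma> \<eta> \<phi>X \<phi>Y compr X0"

definition S :: "nat \<Rightarrow> 'w \<Rightarrow> ('d, 'n) alg_state" where
  "S k \<omega> = alg (\<lambda>c j i. seed c j i \<omega>) k"

lemma grads_measurable: "grads F \<in> borel_measurable borel"
proof -
  have "L-lipschitz_on UNIV (grads F)"
  proof (rule lipschitz_onI)
    fix X Y :: "real^'d^'n"
    have "(norm (grads F X - grads F Y))\<^sup>2 \<le> (L * norm (X - Y))\<^sup>2"
      using norm_grads_diff_le[of X Y] by (simp add: power_mult_distrib)
    then show "dist (grads F X) (grads F Y) \<le> L * dist X Y"
      unfolding dist_norm by (rule power2_le_imp_le) (use L in auto)
  qed (use L in auto)
  then show ?thesis
    by (intro borel_measurable_continuous_onI lipschitz_on_continuous_on)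
qed

lemma avg_cost_measurable [measurable]: "avg_cost F \<in> borel_measurable borel"
  using GDERIV_avg
  by (intro borel_measurable_continuous_onI continuous_at_imp_continuous_on)
    (auto simp: gderiv_def intro: has_derivative_continuous)

lemma gradient_avg_measurable [measurable]: "gradient (avg_cost F) \<in> borel_measurable borel"
proof -
  have "(\<lambda>x. grads F (rep x)) \<in> borel_measurable borel"
    by (rule measurable_compose[OF _ grads_measurable]) measurable
  then have "(\<lambda>x. avg (grads F (rep x))) \<in> borel_measurable borel"
    by measurable
  then show ?thesis by (simp add: gradient_avg[abs_def])
qed

lemma seed_measurable: "seed c k i \<in> M \<rightarrow>\<^sub>M R"
  using seed_indep unfolding indep_vars_def by auto

lemmas alg_measurable = algorithm_measurable[OF _ comp_meas grads_measurable]

lemmas S_measurable [measurable] =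
  alg_measurable[of seed M W \<gamma> \<eta> \<phi>X \<phi>Y X0, OF seed_measurable, folded S_def]

text \<open>The current seed and a quantity fixed by the past are functions of disjoint groups of
  seeds, \<open>A\<close> and \<open>B\<close>. The two assumptions on \<open>h\<close> say that it
  factors measurably through the group \<open>B\<close>.\<close>

lemma current_seed_joint:
  fixes h :: "('d, 'n) alg_state \<Rightarrow> real^'d"
  assumes past: "\<And>sd sd'. (\<And>c j i. j < k \<Longrightarrow> sd c j i = sd' c j i) \<Longrightarrow> h (alg sd k) = h (alg sd' k)"
    and meas: "\<And>(N :: (channel \<times> nat \<times> 'n \<Rightarrow> 'r) measure) sd. (\<And>c j i. sd c j i \<in> N \<rightarrow>\<^sub>M R) \<Longrightarrow>
       (\<lambda>\<omega>. h (alg (\<lambda>c j i. sd c j i \<omega>) k)) \<in> borel_measurable N"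
  shows "distr M R (seed c k i) \<Otimes>\<^sub>M distr M borel (\<lambda>\<omega>. h (S k \<omega>))
    = distr M (R \<Otimes>\<^sub>M borel) (\<lambda>\<omega>. (seed c k i \<omega>, h (S k \<omega>)))"
proof -
  define A where "A = {(c, k, i)}"
  define B where "B = {(c :: channel, j, i :: 'n). j < k}"
  interpret R: prob_space R by (rule R)
  \<comment> \<open>A default seed for the times from \<open>k\<close> on: \<open>g\<close> then
    reads coordinates in \<open>B\<close> only, which makes it measurable on that product, and
    \<open>past\<close> shows that the replacement has no effect.\<close>
  obtain s0 where s0: "s0 \<in> space R"
    using R.not_empty by auto
  define f where "f p = p (c, k, i)" for p :: "channel \<times> nat \<times> 'n \<Rightarrow> 'r"
  define g where "g p = h (alg (\<lambda>c j i. if j < k then p (c, j, i) else s0) k)" for p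
  have f: "f \<in> PiM A (\<lambda>_. R) \<rightarrow>\<^sub>M R"
    unfolding f_def A_def by (rule measurable_component_singleton) simp
  have g: "g \<in> borel_measurable (PiM B (\<lambda>_. R))"
    unfolding g_def
  proof (rule meas)
    fix c j i
    show "(\<lambda>p. if j < k then p (c, j, i) else s0) \<in> PiM B (\<lambda>_. R) \<rightarrow>\<^sub>M R"
      using s0 by (cases "j < k") (auto simp: B_def intro!: measurable_component_singleton)
  qed
  have indep: "indep_var (PiM A (\<lambda>_. R)) (\<lambda>\<omega>. restrict (\<lambda>x. (case x of (c, k, i) \<Rightarrow> seed c k i) \<omega>) A)
      (PiM B (\<lambda>_. R)) (\<lambda>\<omega>. restrict (\<lambda>x. (case x of (c, k, i) \<Rightarrow> seed c k i) \<omega>) B)"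
    by (rule indep_var_restrict[OF seed_indep]) (auto simp: A_def B_def)
  have f_eq: "f (restrict (\<lambda>x. (case x of (c, k, i) \<Rightarrow> seed c k i) \<omega>) A) = seed c k i \<omega>" for \<omega>
    by (simp add: f_def A_def)
  have g_eq: "g (restrict (\<lambda>x. (case x of (c, k, i) \<Rightarrow> seed c k i) \<omega>) B) = h (S k \<omega>)" for \<omega>
    unfolding g_def S_def by (rule past) (simp add: B_def)
  show ?thesis
    using indep_var_pair_distr[OF indep f g] unfolding f_eq g_eq .
qed

abbreviation "q \<equiv> 1 - \<sigma>"

definition Phi :: "nat \<Rightarrow> 'w \<Rightarrow> real" where
  "Phi k \<omega> = potential q F Fstar \<phi> (stX (S k \<omega>)) (stY (S k \<omega>)) (stA (S k \<omega>)) (stC (S k \<omega>))"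

definition gap :: "nat \<Rightarrow> 'w \<Rightarrow> real" where
  "gap k \<omega> = real CARD('n) * (avg_cost F (avg (stX (S k \<omega>))) - Fstar)"

definition disagreement :: "nat \<Rightarrow> 'w \<Rightarrow> real" where
  "disagreement k \<omega> = (norm (stX (S k \<omega>) - rep (avg (stX (S k \<omega>)))))\<^sup>2"

definition stationarity :: "nat \<Rightarrow> 'w \<Rightarrow> real" where
  "stationarity k \<omega> = real CARD('n) * (norm (gradient (avg_cost F) (avg (stX (S k \<omega>)))))\<^sup>2"

definition loss :: "nat \<Rightarrow> 'w \<Rightarrow> real" where
  "loss k \<omega> = 0.9 * \<gamma> * q * disagreement k \<omega>
     + 0.7 * \<gamma> * q * (\<phi> * (norm (stY (S k \<omega>) - rep (avg (stY (S k \<omega>)))))\<^sup>2)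
     + 0.7 * c1 * (norm (stX (S k \<omega>) - stA (S k \<omega>)))\<^sup>2
     + 0.9 * c2 * (q * (norm (stY (S k \<omega>) - stC (S k \<omega>)))\<^sup>2) + \<eta> / 2 * stationarity k \<omega>"

definition excess :: "nat \<Rightarrow> 'w \<Rightarrow> real" where
  "excess k \<omega> = excess_weight_X * compression_excess r \<psi> (stX (S k \<omega>) - stA (S k \<omega>)) (stQX (S k \<omega>))
     + excess_weight_Y * compression_excess r \<psi> (stY (S k \<omega>) - stC (S k \<omega>)) (stQY (S k \<omega>))"

lemma gap_nonneg: "0 \<le> gap k \<omega>"
  using Fstar_le by (simp add: gap_def)

lemma Phi_bounds:
  shows "gap k \<omega> \<le> Phi k \<omega>" "disagreement k \<omega> \<le> Phi k \<omega>"
    "\<phi> * (norm (stY (S k \<omega>) - rep (avg (stY (S k \<omega>)))))\<^sup>2 \<le> Phi k \<omega>"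
    "(norm (stX (S k \<omega>) - stA (S k \<omega>)))\<^sup>2 \<le> Phi k \<omega>"
    "q * (norm (stY (S k \<omega>) - stC (S k \<omega>)))\<^sup>2 \<le> Phi k \<omega>"
proof -
  have "0 \<le> \<phi> * (norm (stY (S k \<omega>) - rep (avg (stY (S k \<omega>)))))\<^sup>2"
    "0 \<le> q * (norm (stY (S k \<omega>) - stC (S k \<omega>)))\<^sup>2"
    using phi_pos q by simp_all
  then show "gap k \<omega> \<le> Phi k \<omega>" "disagreement k \<omega> \<le> Phi k \<omega>"
    "\<phi> * (norm (stY (S k \<omega>) - rep (avg (stY (S k \<omega>)))))\<^sup>2 \<le> Phi k \<omega>"
    "(norm (stX (S k \<omega>) - stA (S k \<omega>)))\<^sup>2 \<le> Phi k \<omega>"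
    "q * (norm (stY (S k \<omega>) - stC (S k \<omega>)))\<^sup>2 \<le> Phi k \<omega>"
    using gap_nonneg[of k \<omega>] by (simp_all add: Phi_def potential_def gap_def disagreement_def)
qed

lemma Phi_nonneg: "0 \<le> Phi k \<omega>"
  using gap_nonneg Phi_bounds(1) by (rule order_trans)

lemma S_step:
  fixes k \<omega>
  defines "s \<equiv> S k \<omega>" and "s' \<equiv> S (Suc k) \<omega>"
  shows "stX s' = stX s - \<gamma> *\<^sub>R (stA s - mix W (stA s) + stQX s - mix W (stQX s)) - \<eta> *\<^sub>R stY s"
    and "stY s' = stY s - \<gamma> *\<^sub>R (stC s - mix W (stC s) + stQY s - mix W (stQY s)) + grads F (stX s') - grads F (stX s)"
    and "stA s' = stA s + \<phi>X *\<^sub>R stQX s" and "stC s' = stC s + \<phi>Y *\<^sub>R stQY s"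
  using algorithm_invariants(1,2)[of W F \<gamma> \<eta> \<phi>X \<phi>Y compr X0 "\<lambda>c j i. seed c j i \<omega>" k, folded S_def]
  unfolding s_def s'_def S_def algorithm.simps by (simp_all add: alg_step_def Let_def)

lemma S_avg: "avg (stY (S k \<omega>)) = avg (grads F (stX (S k \<omega>)))"
proof (induction k)
  case 0
  then show ?case by (simp add: S_def alg_init_def)
next
  case (Suc k)
  show ?case by (rule avg_tracking[OF Suc S_step(2)])
qed

lemma Phi_descent: "Phi (Suc k) \<omega> + loss k \<omega> \<le> Phi k \<omega> + excess k \<omega>"
  using potential_descent[OF S_avg S_step(1,2), of k \<omega>]
  unfolding Phi_def S_step(3,4) loss_def excess_def disagreement_def stationarity_def
  by (simp add: potential_def algebra_simps)

lemma measurable_quantities [measurable]: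
  "Phi k \<in> borel_measurable M" "gap k \<in> borel_measurable M" "disagreement k \<in> borel_measurable M"
  "stationarity k \<in> borel_measurable M"
  unfolding Phi_def gap_def disagreement_def stationarity_def potential_def by measurable

lemma excess_expectation:
  assumes "integrable M (Phi k)"
  shows "integrable M (excess k)" "expectation (excess k) \<le> 0"
proof -
  have bdd: "integrable M f" if "f \<in> borel_measurable M" "\<And>\<omega>. 0 \<le> f \<omega>" "\<And>\<omega>. f \<omega> \<le> Phi k \<omega>" for f
    by (rule Bochner_Integration.integrable_bound[OF assms that(1)]) (use that Phi_nonneg in auto)
  have zx: "integrable M (\<lambda>\<omega>. (norm (stX (S k \<omega>) - stA (S k \<omega>)))\<^sup>2)"
    by (rule bdd) (auto simp: Phi_bounds)
  have "integrable M (\<lambda>\<omega>. q * (norm (stY (S k \<omega>) - stC (S k \<omega>)))\<^sup>2)"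
    using q by (intro bdd) (auto simp: Phi_bounds)
  then have zy: "integrable M (\<lambda>\<omega>. (norm (stY (S k \<omega>) - stC (S k \<omega>)))\<^sup>2)"
    using q by simp
  note inv = algorithm_invariants(3,4)[of W F \<gamma> \<eta> \<phi>X \<phi>Y compr X0, of "\<lambda>c j i. seed c j i \<omega>" for \<omega>, folded S_def]
  note past = algorithm_past[of k _ _ W F \<gamma> \<eta> \<phi>X \<phi>Y compr X0]
  have jx: "distr M R (seed ChanX k i) \<Otimes>\<^sub>M distr M borel (\<lambda>\<omega>. (stX (S k \<omega>) - stA (S k \<omega>)) $ i)
      = distr M (R \<Otimes>\<^sub>M borel) (\<lambda>\<omega>. (seed ChanX k i \<omega>, (stX (S k \<omega>) - stA (S k \<omega>)) $ i))" for i
  proof (rule current_seed_joint[where h = "\<lambda>s. (stX s - stA s) $ i"])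
    show "(stX (alg sd k) - stA (alg sd k)) $ i = (stX (alg sd' k) - stA (alg sd' k)) $ i"
      if "\<And>c j i. j < k \<Longrightarrow> sd c j i = sd' c j i" for sd sd'
      using past(1,3)[OF that] by simp
    fix N :: "(channel \<times> nat \<times> 'n \<Rightarrow> 'r) measure"
      and sd :: "channel \<Rightarrow> nat \<Rightarrow> 'n \<Rightarrow> (channel \<times> nat \<times> 'n \<Rightarrow> 'r) \<Rightarrow> 'r"
    assume sd: "\<And>c j i. sd c j i \<in> N \<rightarrow>\<^sub>M R"
    note [measurable] = alg_measurable(1,3)[OF sd]
    show "(\<lambda>\<omega>. (stX (alg (\<lambda>c j i. sd c j i \<omega>) k) - stA (alg (\<lambda>c j i. sd c j i \<omega>) k)) $ i) \<in> borel_measurable N"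
      by measurable
  qed
  have jy: "distr M R (seed ChanY k i) \<Otimes>\<^sub>M distr M borel (\<lambda>\<omega>. (stY (S k \<omega>) - stC (S k \<omega>)) $ i)
      = distr M (R \<Otimes>\<^sub>M borel) (\<lambda>\<omega>. (seed ChanY k i \<omega>, (stY (S k \<omega>) - stC (S k \<omega>)) $ i))" for i
  proof (rule current_seed_joint[where h = "\<lambda>s. (stY s - stC s) $ i"])
    show "(stY (alg sd k) - stC (alg sd k)) $ i = (stY (alg sd' k) - stC (alg sd' k)) $ i"
      if "\<And>c j i. j < k \<Longrightarrow> sd c j i = sd' c j i" for sd sd'
      using past(2,4)[OF that] by simp
    fix N :: "(channel \<times> nat \<times> 'n \<Rightarrow> 'r) measure"
      and sd :: "channel \<Rightarrow> nat \<Rightarrow> 'n \<Rightarrow> (channel \<times> nat \<times> 'n \<Rightarrow> 'r) \<Rightarrow> 'r"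
    assume sd: "\<And>c j i. sd c j i \<in> N \<rightarrow>\<^sub>M R"
    note [measurable] = alg_measurable(2,4)[OF sd]
    show "(\<lambda>\<omega>. (stY (alg (\<lambda>c j i. sd c j i \<omega>) k) - stC (alg (\<lambda>c j i. sd c j i \<omega>) k)) $ i) \<in> borel_measurable N"
      by measurable
  qed
  note EX = compression_excess_expectation[OF R comp_meas contract_integrable contract psi seed_distr
      seed_measurable jx inv(1) _ _ zx]
  note EY = compression_excess_expectation[OF R comp_meas contract_integrable contract psi seed_distr
      seed_measurable jy inv(2) _ _ zy]
  have ix: "integrable M (\<lambda>\<omega>. compression_excess r \<psi> (stX (S k \<omega>) - stA (S k \<omega>)) (stQX (S k \<omega>)))"
    and iy: "integrable M (\<lambda>\<omega>. compression_excess r \<psi> (stY (S k \<omega>) - stC (S k \<omega>)) (stQY (S k \<omega>)))"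
    by (rule EX(1) EY(1); measurable)+
  then show "integrable M (excess k)"
    unfolding excess_def by auto
  have "(\<integral>\<omega>. compression_excess r \<psi> (stX (S k \<omega>) - stA (S k \<omega>)) (stQX (S k \<omega>)) \<partial>M) \<le> 0"
    "(\<integral>\<omega>. compression_excess r \<psi> (stY (S k \<omega>) - stC (S k \<omega>)) (stQY (S k \<omega>)) \<partial>M) \<le> 0"
    by (rule EX(2) EY(2); measurable)+
  with ix iy excess_weight_nonneg show "expectation (excess k) \<le> 0"
    unfolding excess_def by (simp add: mult_nonneg_nonpos add_nonpos_nonpos)
qed

lemma loss_nonneg_parts:
  "0 \<le> disagreement k \<omega>" "0 \<le> stationarity k \<omega>"
  "0.9 * \<gamma> * q * disagreement k \<omega> + \<eta> / 2 * stationarity k \<omega> \<le> loss k \<omega>"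
  using q g c1 c2 phi_pos by (simp_all add: disagreement_def stationarity_def loss_def)

lemma loss_nonneg: "0 \<le> loss k \<omega>"
  using loss_nonneg_parts[of k \<omega>] q g h by (intro order_trans[OF _ loss_nonneg_parts(3)]) simp

text \<open>In \<open>Phi_descent\<close> both terms on the left are nonnegative, so each is
  dominated by \<open>Phi k + excess k\<close>. Integrability thus propagates in time along with the
  decrease.\<close>

lemma expectation_step:
  assumes Phi: "integrable M (Phi k)"
  shows "integrable M (disagreement k)" "integrable M (stationarity k)" "integrable M (gap k)"
    "integrable M (loss k)" "integrable M (Phi (Suc k))"
    "expectation (Phi (Suc k)) + expectation (loss k) \<le> expectation (Phi k)"
proof -
  note E = excess_expectation[OF Phi]
  have bound: "integrable M (\<lambda>\<omega>. Phi k \<omega> + excess k \<omega>)"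
    using Phi E by auto
  have int: "integrable M f" if "f \<in> borel_measurable M" "\<And>\<omega>. 0 \<le> f \<omega>" "\<And>\<omega>. f \<omega> \<le> Phi k \<omega> + excess k \<omega>" for f
    by (rule Bochner_Integration.integrable_bound[OF bound that(1)])
      (use that(2,3) in \<open>auto intro!: AE_I2 intro: order_trans[OF _ abs_ge_self]\<close>)
  have lossm: "loss k \<in> borel_measurable M"
    unfolding loss_def by measurable
  have le: "loss k \<omega> \<le> Phi k \<omega> + excess k \<omega>" "Phi (Suc k) \<omega> \<le> Phi k \<omega> + excess k \<omega>" for \<omega>
    using Phi_descent[of k \<omega>] Phi_nonneg[of "Suc k" \<omega>] loss_nonneg[of k \<omega>] by linarith+
  show loss: "integrable M (loss k)"
    by (rule int[OF lossm loss_nonneg le(1)])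
  show Phi': "integrable M (Phi (Suc k))"
    by (rule int[OF measurable_quantities(1) Phi_nonneg le(2)])
  \<comment> \<open>The squared gradient is not a summand of the potential; it is dominated by the
    loss instead.\<close>
  have "integrable M (\<lambda>\<omega>. \<eta> / 2 * stationarity k \<omega>)"
  proof (rule Bochner_Integration.integrable_bound[OF loss])
    show "AE \<omega> in M. norm (\<eta> / 2 * stationarity k \<omega>) \<le> norm (loss k \<omega>)"
    proof (rule AE_I2)
      fix \<omega>
      have "0 \<le> 0.9 * \<gamma> * q * disagreement k \<omega>"
        using q g loss_nonneg_parts(1) by simp
      with loss_nonneg_parts(2,3)[of k \<omega>] h loss_nonneg[of k \<omega>]
      show "norm (\<eta> / 2 * stationarity k \<omega>) \<le> norm (loss k \<omega>)" by simp
    qed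
  qed measurable
  then have *: "integrable M (\<lambda>\<omega>. 2 / \<eta> * (\<eta> / 2 * stationarity k \<omega>))"
    by (rule integrable_mult_right)
  have "2 / \<eta> * (\<eta> / 2 * x) = x" for x
    using h by simp
  with * show "integrable M (stationarity k)"
    by (simp only:)
  show "integrable M (disagreement k)" "integrable M (gap k)"
    by (rule Bochner_Integration.integrable_bound[OF Phi];
        use Phi_bounds gap_nonneg loss_nonneg_parts(1) Phi_nonneg in auto)+
  have "expectation (\<lambda>\<omega>. Phi (Suc k) \<omega> + loss k \<omega>) \<le> expectation (\<lambda>\<omega>. Phi k \<omega> + excess k \<omega>)"
    using Phi' loss bound Phi_descent by (intro integral_mono) auto
  then show "expectation (Phi (Suc k)) + expectation (loss k) \<le> expectation (Phi k)"
    using Phi' loss Phi E by simp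
qed

lemma Phi_0: "Phi 0 \<omega> = potential q F Fstar \<phi> X0 (grads F X0) 0 0"
  by (simp add: Phi_def S_def alg_init_def)

lemma integrable_Phi: "integrable M (Phi k)"
proof (induction k)
  case 0
  then show ?case by (simp add: Phi_0[abs_def])
next
  case (Suc k)
  then show ?case by (rule expectation_step)
qed

lemma expectation_Phi_sum:
  "expectation (Phi (Suc k)) + (\<Sum>t\<le>k. expectation (loss t)) \<le> potential q F Fstar \<phi> X0 (grads F X0) 0 0"
proof (induction k)
  case 0
  then show ?case
    using expectation_step(6)[OF integrable_Phi, of 0] by (simp add: Phi_0[abs_def] prob_space)
next
  case (Suc k)
  then show ?case
    using expectation_step(6)[OF integrable_Phi, of "Suc k"] by simp
qed

lemma potential_le_lyapunov_U:
  "potential q F Fstar \<phi> X0 (grads F X0) 0 0 \<le> lyapunov_U F Fstar \<phi> X0 (grads F X0) 0 0"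
  using q by (simp add: potential_def lyapunov_U_def lyapunov_V_def mult_left_le_one_le)

lemma expectation_sum_bound:
  assumes "\<theta> \<le> 0.9 * \<gamma> * q" "\<theta> \<le> \<eta> / 2" "0 < \<theta>"
  shows "(\<Sum>t\<le>k. expectation (\<lambda>\<omega>. disagreement t \<omega> + stationarity t \<omega>))
    \<le> lyapunov_U F Fstar \<phi> X0 (grads F X0) 0 0 / \<theta>"
proof -
  have "\<theta> * expectation (\<lambda>\<omega>. disagreement t \<omega> + stationarity t \<omega>) \<le> expectation (loss t)" for t
  proof -
    note I = expectation_step(1,2,4)[OF integrable_Phi, of t]
    have "\<theta> * (disagreement t \<omega> + stationarity t \<omega>) \<le> loss t \<omega>" for \<omega>
      using mult_right_mono[OF assms(1) loss_nonneg_parts(1)[of t \<omega>]]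
        mult_right_mono[OF assms(2) loss_nonneg_parts(2)[of t \<omega>]] loss_nonneg_parts(3)[of t \<omega>]
      unfolding distrib_left by linarith
    then have "expectation (\<lambda>\<omega>. \<theta> * (disagreement t \<omega> + stationarity t \<omega>)) \<le> expectation (loss t)"
      using I by (intro integral_mono) auto
    then show ?thesis by simp
  qed
  then have "\<theta> * (\<Sum>t\<le>k. expectation (\<lambda>\<omega>. disagreement t \<omega> + stationarity t \<omega>)) \<le> (\<Sum>t\<le>k. expectation (loss t))"
    unfolding sum_distrib_left by (intro sum_mono)
  moreover have "0 \<le> expectation (Phi (Suc k))"
    by (intro Bochner_Integration.integral_nonneg Phi_nonneg)
  ultimately have "\<theta> * (\<Sum>t\<le>k. expectation (\<lambda>\<omega>. disagreement t \<omega> + stationarity t \<omega>))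
      \<le> lyapunov_U F Fstar \<phi> X0 (grads F X0) 0 0"
    using expectation_Phi_sum[of k] potential_le_lyapunov_U by linarith
  then show ?thesis
    using assms(3) by (simp add: pos_le_divide_eq mult.commute)
qed

text \<open>At time 0 the gap is exactly U(0) - V(0). At later times the margin is the loss of the
  first step, which is positive as soon as V(0) is.\<close>

lemma expectation_gap:
  shows "expectation (gap k) \<le> lyapunov_U F Fstar \<phi> X0 (grads F X0) 0 0"
    and "0 < lyapunov_V \<phi> X0 (grads F X0) 0 0 \<Longrightarrow>
      expectation (gap k) < lyapunov_U F Fstar \<phi> X0 (grads F X0) 0 0"
proof -
  let ?V = "lyapunov_V \<phi> X0 (grads F X0) 0 0" and ?U = "lyapunov_U F Fstar \<phi> X0 (grads F X0) 0 0"
  have V: "0 \<le> ?V"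
    using phi_pos by (simp add: lyapunov_V_def)
  have "expectation (gap k) \<le> ?U \<and> (0 < ?V \<longrightarrow> expectation (gap k) < ?U)"
  proof (cases k)
    case 0
    have "gap 0 \<omega> = ?U - ?V" for \<omega>
      by (simp add: gap_def S_def alg_init_def lyapunov_U_def)
    then have "gap k = (\<lambda>_. ?U - ?V)"
      by (simp add: 0 fun_eq_iff)
    then have "expectation (gap k) = ?U - ?V"
      by (simp add: prob_space)
    with V show ?thesis by simp
  next
    case (Suc m)
    have "expectation (gap k) \<le> expectation (Phi k)"
      by (intro integral_mono expectation_step(3) integrable_Phi Phi_bounds)
    moreover have "expectation (loss 0) \<le> (\<Sum>t\<le>m. expectation (loss t))"
      by (rule member_le_sum) (auto intro!: Bochner_Integration.integral_nonneg loss_nonneg)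
    \<comment> \<open>The loss at time 0 involves only the initial \<open>X\<close>,
      \<open>Y\<close>, \<open>A\<close>, \<open>C\<close>, which are deterministic.\<close>
    moreover have "expectation (loss 0) = loss 0 \<omega>" for \<omega>
    proof -
      define l where "l = loss 0 \<omega>"
      have "loss 0 = (\<lambda>_. l)"
        by (simp add: l_def fun_eq_iff loss_def disagreement_def stationarity_def S_def alg_init_def)
      then show ?thesis
        by (simp add: prob_space)
    qed
    moreover have "0 < loss 0 \<omega>" if "0 < ?V" for \<omega>
    proof -
      \<comment> \<open>The smallest rate at which the loss consumes a summand of V; the factor
        \<open>q\<close> beside \<open>c2\<close> comes from the lowered weight in the
        potential.\<close>
      define \<delta> where "\<delta> = min (min (0.9 * \<gamma> * q) (0.7 * \<gamma> * q)) (min (0.7 * c1) (0.9 * c2 * q))"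
      have "0 < \<delta>"
        using g q c1 c2 by (simp add: \<delta>_def)
      then have "0 < \<delta> * ?V"
        using that by simp
      also have "\<delta> * ?V = \<delta> * disagreement 0 \<omega> + \<delta> * (\<phi> * (norm (grads F X0 - rep (avg (grads F X0))))\<^sup>2)
          + \<delta> * (norm X0)\<^sup>2 + \<delta> * (norm (grads F X0))\<^sup>2"
        by (simp add: lyapunov_V_def disagreement_def S_def alg_init_def distrib_left)
      also have "\<dots> \<le> 0.9 * \<gamma> * q * disagreement 0 \<omega>
          + 0.7 * \<gamma> * q * (\<phi> * (norm (grads F X0 - rep (avg (grads F X0))))\<^sup>2)
          + 0.7 * c1 * (norm X0)\<^sup>2 + 0.9 * c2 * q * (norm (grads F X0))\<^sup>2"
        using phi_pos by (intro add_mono mult_right_mono) (auto simp: \<delta>_def loss_nonneg_parts)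
      also have "\<dots> \<le> loss 0 \<omega>"
        using h loss_nonneg_parts(2)[of 0 \<omega>] by (simp add: loss_def S_def alg_init_def mult.assoc)
      finally show ?thesis .
    qed
    moreover have "expectation (Phi k) + (\<Sum>t\<le>m. expectation (loss t)) \<le> ?U"
      using expectation_Phi_sum[of m] potential_le_lyapunov_U by (simp add: Suc)
    moreover have "0 \<le> expectation (loss 0)"
      by (intro Bochner_Integration.integral_nonneg loss_nonneg)
    \<comment> \<open>Any sample point would do, as \<open>loss 0\<close> is constant.\<close>
    ultimately have "expectation (gap k) + loss 0 undefined \<le> ?U" "0 \<le> loss 0 undefined"
        "0 < ?V \<longrightarrow> 0 < loss 0 undefined"
      by auto
    then show ?thesis
      by auto
  qed
  then show "expectation (gap k) \<le> ?U" "0 < ?V \<Longrightarrow> expectation (gap k) < ?U"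
    by auto
qed

end

section \<open>From the stated step size bounds to the final estimate\<close>

lemma less_gamma_maxD:
  assumes "ereal \<gamma> < gamma_max \<sigma> L c1 c2 C"
  shows "\<gamma> < (1 - \<sigma>) / (160 * (1 + 1 / c1))" "\<gamma> < (1 - \<sigma>) / (40000 * (1 + 1 / c2) * L\<^sup>2)"
    "ereal \<gamma> < ereal (c1 * (1 - \<sigma>)) / ereal (40 * C)" "ereal \<gamma> < ereal (c2 * L\<^sup>2) / ereal C"
proof -
  have "\<gamma> < (1 - \<sigma>) / (160 * (1 + 1 / c1)) \<and> \<gamma> < (1 - \<sigma>) / (40000 * (1 + 1 / c2) * L\<^sup>2) \<and>
    ereal \<gamma> < ereal (c1 * (1 - \<sigma>)) / ereal (40 * C) \<and> ereal \<gamma> < ereal (c2 * L\<^sup>2) / ereal C"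
    using assms unfolding gamma_max_def by (subst (asm) Min_gr_iff) (simp_all del: ereal_divide)
  then show "\<gamma> < (1 - \<sigma>) / (160 * (1 + 1 / c1))" "\<gamma> < (1 - \<sigma>) / (40000 * (1 + 1 / c2) * L\<^sup>2)"
    "ereal \<gamma> < ereal (c1 * (1 - \<sigma>)) / ereal (40 * C)" "ereal \<gamma> < ereal (c2 * L\<^sup>2) / ereal C"
    by blast+
qed

lemma less_eta_maxD:
  assumes "\<eta> < eta_max \<sigma> L c1 c2 \<gamma>"
  shows "\<eta> < (1 - \<sigma>)\<^sup>2 * \<gamma> / (40 * L)" "\<eta> < 0.4 * (1 - \<sigma>) * \<gamma> / L\<^sup>2"
    "\<eta> < 9 / (40 * (4 * (1 + 1 / c1) + 5 * (1 + 1 / c2)))" "\<eta> < 1 / (2 * L)" "\<eta> < \<gamma>"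
proof -
  have "\<eta> < (1 - \<sigma>)\<^sup>2 * \<gamma> / (40 * L) \<and> \<eta> < 0.4 * (1 - \<sigma>) * \<gamma> / L\<^sup>2 \<and>
    \<eta> < 9 / (40 * (4 * (1 + 1 / c1) + 5 * (1 + 1 / c2))) \<and> \<eta> < 1 / (2 * L) \<and> \<eta> < \<gamma>"
    using assms unfolding eta_max_def by (subst (asm) Min_gr_iff) simp_all
  then show "\<eta> < (1 - \<sigma>)\<^sup>2 * \<gamma> / (40 * L)" "\<eta> < 0.4 * (1 - \<sigma>) * \<gamma> / L\<^sup>2"
    "\<eta> < 9 / (40 * (4 * (1 + 1 / c1) + 5 * (1 + 1 / c2)))" "\<eta> < 1 / (2 * L)" "\<eta> < \<gamma>"
    by blast+
qed

lemma step_sizesI: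
  assumes \<sigma>: "0 < \<sigma>" "\<sigma> < 1" and L: "0 < L"
    and \<gamma>: "0 < \<gamma>" "ereal \<gamma> < gamma_max \<sigma> L c1 c2 C" and \<eta>: "0 < \<eta>" "\<eta> < eta_max \<sigma> L c1 c2 \<gamma>"
    and c1: "0 < c1" and c2: "0 < c2" and C: "0 \<le> C" and \<phi>: "\<phi> = (1 - \<sigma>)\<^sup>2 / (320 * L\<^sup>2)"
  shows "step_sizes (1 - \<sigma>) L \<gamma> \<eta> c1 c2 C \<phi>"
proof -
  define q where "q = 1 - \<sigma>"
  have q: "0 < q" "q \<le> 1"
    using \<sigma> by (auto simp: q_def)
  note g = less_gamma_maxD[OF \<gamma>(2), folded q_def]
  note e = less_eta_maxD[OF \<eta>(2), folded q_def]
  define a1 a2 where "a1 = 1 + 1 / c1" and "a2 = 1 + 1 / c2"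
  have pos: "0 < a1" "0 < a2"
    using c1 c2 by (simp_all add: a1_def a2_def add_pos_pos)
  have "\<gamma> * (160 * a1) < q" "\<gamma> * (40000 * a2 * L\<^sup>2) < q"
    using g(1,2) pos L unfolding a1_def[symmetric] a2_def[symmetric]
    by (auto simp only: pos_less_divide_eq zero_less_power mult_pos_pos zero_less_numeral)
  then have b12: "\<gamma> * (1 + 1 / c1) \<le> q / 160" "\<gamma> * (1 + 1 / c2) * L\<^sup>2 \<le> q / 40000"
    unfolding a1_def[symmetric] a2_def[symmetric] by simp_all
  \<comment> \<open>For \<open>C = 0\<close> the extended real quotients are infinite and carry no
    information, but then the left sides vanish. For \<open>C > 0\<close> they are real
    quotients.\<close>
  have "\<gamma> * C \<le> c1 * q / 40 \<and> \<gamma> * C \<le> c2 * L\<^sup>2"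
  proof (cases "C = 0")
    case True
    then show ?thesis using c1 c2 q by simp
  next
    case False
    with C have "0 < C" by simp
    have "\<gamma> < c1 * q / (40 * C)" "\<gamma> < c2 * L\<^sup>2 / C"
      using g(3,4) False unfolding ereal_divide by auto
    with \<open>0 < C\<close> have "\<gamma> * (40 * C) < c1 * q" "\<gamma> * C < c2 * L\<^sup>2"
      by (simp_all only: pos_less_divide_eq mult_pos_pos zero_less_numeral)
    then show ?thesis by linarith
  qed
  then have b34: "\<gamma> * C \<le> c1 * q / 40" "\<gamma> * C \<le> c2 * L\<^sup>2"
    by simp_all
  have "\<eta> * (40 * L) < q\<^sup>2 * \<gamma>" "\<eta> * L\<^sup>2 < 0.4 * q * \<gamma>" "\<eta> * (2 * L) < 1"
    using e(1,2,4) L by (simp_all only: pos_less_divide_eq zero_less_power mult_pos_pos zero_less_numeral)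
  then have e': "\<eta> * L \<le> q\<^sup>2 * \<gamma> / 40" "\<eta> * L\<^sup>2 \<le> 0.4 * q * \<gamma>" "\<eta> * L \<le> 1 / 2"
    by linarith+
  show ?thesis
    unfolding q_def[symmetric]
    by (rule step_sizes.intro[OF q L \<gamma>(1) \<eta>(1) c1 c2 C b12 b34 e'(1,2) less_imp_le[OF e(5)] e'(3)
          \<phi>[folded q_def]])
qed

text \<open>Strictness in the second bound is tied to \<open>V0 > 0\<close>: if
  \<open>V0 = 0\<close>, then \<open>X0\<close> and the initial gradients are 0, and the gap at time
  0 equals \<open>U0\<close>.\<close>

theorem theorem1:
  fixes G :: "'n::finite pair_pre_digraph"
    and W :: "real^'n^'n"
    and F :: "'n \<Rightarrow> real^'d::finite \<Rightarrow> real"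
    and R :: "'r measure" and compr :: "'r \<Rightarrow> real^'d \<Rightarrow> real^'d"
    and M :: "'w measure" and seed :: "channel \<Rightarrow> nat \<Rightarrow> 'n \<Rightarrow> 'w \<Rightarrow> 'r"
    and X0 :: "real^'d^'n"
    and \<sigma> L r \<psi> \<phi>X \<phi>Y \<gamma> \<eta> Fstar c1 c2 C \<phi> \<epsilon>1 \<epsilon>2 \<epsilon>3 \<theta>1 \<theta>2 \<theta>3 U0 V0 n :: real
    and S :: "nat \<Rightarrow> 'w \<Rightarrow> ('d, 'n) alg_state"
  assumes n: "n = real CARD('n)"
    \<comment> \<open>costs\<close>
    and diff: "\<And>i x. F i differentiable at x"
    and argmin: "\<exists>x. is_arg_min (avg_cost F) (\<lambda>_. True) x"
    and Fstar: "Fstar = (INF x. avg_cost F x)"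
    \<comment> \<open>communication graph\<close>
    and verts: "pverts G = UNIV"
    and conn: "strongly_connected (with_proj G)"
    and W: "weight_matrix G W"
    and sigma: "\<sigma> = spectral_norm (W - (\<chi> i j. 1 / n))" "\<sigma> \<in> {0<..<1}"
    \<comment> \<open>smoothness\<close>
    and L: "L > 0"
    and lipschitz: "\<And>i x y. norm (gradient (F i) x - gradient (F i) y) \<le> L * norm (x - y)"
    \<comment> \<open>compressor\<close>
    and R: "prob_space R"
    and comp_meas: "(\<lambda>(s, x). compr s x) \<in> borel_measurable (R \<Otimes>\<^sub>M borel)"
    and r: "r > 0" and psi: "\<psi> \<in> {0<..1}"
    and contract: "\<And>x. integrable R (\<lambda>s. (norm ((1 / r) *\<^sub>R compr s x - x))\<^sup>2)"
      "\<And>x. (\<integral>s. (norm ((1 / r) *\<^sub>R compr s x - x))\<^sup>2 \<partial>R) \<le> (1 - \<psi>) * (norm x)\<^sup>2"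
    \<comment> \<open>fresh independent randomness for every application of the compressor\<close>
    and M: "prob_space M"
    and seed_indep: "prob_space.indep_vars M (\<lambda>_. R) (\<lambda>(c, k, i). seed c k i) UNIV"
    and seed_distr: "\<And>c k i. distr M R (seed c k i) = R"
    \<comment> \<open>algorithm\<close>
    and S: "\<And>k \<omega>. S k \<omega> = algorithm W F \<gamma> \<eta> \<phi>X \<phi>Y compr X0 (\<lambda>c k i. seed c k i \<omega>) k"
    \<comment> \<open>parameters\<close>
    and phiX: "\<phi>X \<in> {0<..<1 / r}" and phiY: "\<phi>Y \<in> {0<..<1 / r}"
    and c1: "c1 = \<phi>X * \<psi> * r / 2" and c2: "c2 = \<phi>Y * \<psi> * r / 2"
    and C: "C = 2 * r\<^sup>2 * (1 - \<psi>) + 2 * (1 - r)\<^sup>2"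
    and gamma: "0 < \<gamma>" "ereal \<gamma> < gamma_max \<sigma> L c1 c2 C"
    and eta: "0 < \<eta>" "\<eta> < eta_max \<sigma> L c1 c2 \<gamma>"
    and phi: "\<phi> = (1 - \<sigma>)\<^sup>2 / (320 * L\<^sup>2)"
    and eps1: "\<epsilon>1 = 8 * L\<^sup>2 / ((1 - \<sigma>) * \<gamma>) * \<eta>\<^sup>2"
    and eps2: "\<epsilon>2 = 4 * (1 + 1 / c1) * \<eta>\<^sup>2"
    and eps3: "\<epsilon>3 = 5 * (1 + 1 / c2) * \<eta>\<^sup>2"
    and theta2: "\<theta>2 = \<eta> / 4 - (\<phi> * \<epsilon>1 + \<epsilon>2 + \<epsilon>3)"
    and theta3: "\<theta>3 = Min {0.07 * (1 - \<sigma>) * \<gamma>, 0.44 * c1 * (2 * c1 + 1), 0.77 * c2 * (2 * c2 + 1)}"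
    and theta1: "\<theta>1 = min \<theta>2 \<theta>3"
    \<comment> \<open>values of V and U at time 0, where A(0) = C(0) = 0\<close>
    and V0: "V0 = lyapunov_V \<phi> X0 (grads F X0) 0 0"
    and U0: "U0 = lyapunov_U F Fstar \<phi> X0 (grads F X0) 0 0"
  shows "\<forall>k.
    (\<forall>t\<le>k. integrable M (\<lambda>\<omega>. (norm (stX (S t \<omega>) - rep (avg (stX (S t \<omega>)))))\<^sup>2
                              + n * (norm (gradient (avg_cost F) (avg (stX (S t \<omega>)))))\<^sup>2)) \<and>
    (\<Sum>t\<le>k. \<integral>\<omega>. (norm (stX (S t \<omega>) - rep (avg (stX (S t \<omega>)))))\<^sup>2
                  + n * (norm (gradient (avg_cost F) (avg (stX (S t \<omega>)))))\<^sup>2 \<partial>M) \<le> U0 / \<theta>1 \<and>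
    integrable M (\<lambda>\<omega>. n * (avg_cost F (avg (stX (S k \<omega>))) - Fstar)) \<and>
    (\<integral>\<omega>. n * (avg_cost F (avg (stX (S k \<omega>))) - Fstar) \<partial>M) \<le> U0 \<and>
    (V0 > 0 \<longrightarrow> (\<integral>\<omega>. n * (avg_cost F (avg (stX (S k \<omega>))) - Fstar) \<partial>M) < U0)"
proof -
  define q where "q = 1 - \<sigma>"
  have q: "0 < q" "q < 1" "\<sigma> = 1 - q"
    using sigma(2) by (auto simp: q_def)
  have fX: "0 < \<phi>X" "\<phi>X * r < 1" and fY: "0 < \<phi>Y" "\<phi>Y * r < 1"
    using phiX phiY r by (simp_all add: pos_less_divide_eq)
  have c1': "0 < c1" "c1 \<le> 1 / 2" and c2': "0 < c2"
  proof -
    show "0 < c1" "0 < c2"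
      using fX fY psi r by (simp_all add: c1 c2)
    have "(\<phi>X * r) * \<psi> \<le> 1"
      using mult_mono[of "\<phi>X * r" 1 \<psi> 1] fX psi by auto
    then show "c1 \<le> 1 / 2"
      by (simp add: c1 mult_ac)
  qed
  have C0: "0 \<le> C"
    using psi by (simp add: C)
  have e: "\<eta> < q\<^sup>2 * \<gamma> / (40 * L)" "\<eta> < 0.4 * q * \<gamma> / L\<^sup>2"
      "\<eta> < 9 / (40 * (4 * (1 + 1 / c1) + 5 * (1 + 1 / c2)))" "\<eta> < 1 / (2 * L)" "\<eta> < \<gamma>"
    using less_eta_maxD[OF eta(2)] unfolding q_def .
  have pos: "0 < 1 + 1 / c1" "0 < 1 + 1 / c2"
    using c1' c2' by (simp_all add: add_pos_pos)
  have step: "step_sizes (1 - \<sigma>) L \<gamma> \<eta> c1 c2 C \<phi>"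
    by (rule step_sizesI[OF _ _ L gamma eta c1'(1) c2' C0 phi]) (use sigma(2) in auto)
  interpret T: stochastic_tracking \<sigma> L \<gamma> \<eta> c1 c2 C \<phi> W F r \<psi> \<phi>X \<phi>Y Fstar M R compr seed X0
  proof (intro stochastic_tracking.intro compressed_tracking.intro stochastic_tracking_axioms.intro
      compressed_tracking_axioms.intro, fold q_def)
    show "Fstar \<le> avg_cost F x" for x
    proof -
      obtain x0 where "is_arg_min (avg_cost F) (\<lambda>_. True) x0"
        using argmin by blast
      then have "bdd_below (range (avg_cost F))"
        by (intro bdd_belowI[of _ "avg_cost F x0"]) (auto simp: is_arg_min_linorder)
      then show ?thesis
        unfolding Fstar by (intro cINF_lower) auto
    qed
    show "case_prod compr \<in> borel_measurable (R \<Otimes>\<^sub>M borel)"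
      using comp_meas by simp
  qed (use weight_matrix_sums[OF W] sigma(1) diff lipschitz r fX fY c1 c2 C c1' psi R contract M seed_indep seed_distr
      step in \<open>simp_all add: n q_def\<close>)
  have disagreement_stationarity: "(norm (stX (S t \<omega>) - rep (avg (stX (S t \<omega>)))))\<^sup>2
      + n * (norm (gradient (avg_cost F) (avg (stX (S t \<omega>)))))\<^sup>2 = T.disagreement t \<omega> + T.stationarity t \<omega>" for t \<omega>
    by (simp add: S T.S_def T.disagreement_def T.stationarity_def n)
  have gap: "n * (avg_cost F (avg (stX (S k \<omega>))) - Fstar) = T.gap k \<omega>" for k \<omega>
    by (simp add: S T.S_def T.gap_def n)
  \<comment> \<open>Positivity of \<open>\<theta>2\<close> is a budget of \<open>\<eta> / 4\<close>:
    the term \<open>\<phi> * \<epsilon>1\<close> takes at most 1/40 of \<open>\<eta>\<close> because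
    8/320 = 1/40, and the bound on \<open>\<eta>\<close> with numerator 9 keeps
    \<open>\<epsilon>2 + \<epsilon>3\<close> strictly below the remaining 9/40.\<close>
  have theta: "0 < \<theta>1" "\<theta>1 \<le> 0.9 * \<gamma> * (1 - \<sigma>)" "\<theta>1 \<le> \<eta> / 2"
  proof -
    have eps_nonneg: "0 \<le> \<phi> * \<epsilon>1" "0 \<le> \<epsilon>2" "0 \<le> \<epsilon>3"
      using T.phi_pos q gamma(1) pos by (simp_all add: eps1 eps2 eps3)
    have "\<phi> * \<epsilon>1 = (\<phi> * L\<^sup>2) * (8 / (q * \<gamma>) * \<eta>\<^sup>2)"
      by (simp add: eps1 q_def)
    also have "\<dots> = q * (\<eta> * (\<eta> / \<gamma>)) / 40"
      unfolding T.phi_L2 q_def[symmetric] using q by (simp add: power2_eq_square mult_ac)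
    also have "q * (\<eta> * (\<eta> / \<gamma>)) \<le> 1 * (\<eta> * 1)"
      using q e(5) eta(1) gamma(1) by (intro mult_mono) auto
    finally have phi_eps1: "\<phi> * \<epsilon>1 \<le> \<eta> / 40"
      by simp
    have "\<eta> * (40 * (4 * (1 + 1 / c1) + 5 * (1 + 1 / c2))) < 9"
      using e(3) pos by (subst (asm) pos_less_divide_eq) auto
    then have "\<eta> * (\<eta> * (40 * (4 * (1 + 1 / c1) + 5 * (1 + 1 / c2)))) < \<eta> * 9"
      using eta(1) by (intro mult_strict_left_mono)
    then have "\<epsilon>2 + \<epsilon>3 < 9 * \<eta> / 40"
      by (simp add: eps2 eps3 power2_eq_square algebra_simps)
    with phi_eps1 have "0 < \<theta>2"
      by (simp add: theta2)
    moreover have "0 < \<theta>3"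
      unfolding theta3 using gamma(1) c1' c2' q by (subst Min_gr_iff) (simp_all add: add_pos_pos)
    ultimately show "0 < \<theta>1"
      by (simp add: theta1)
    have "\<theta>1 \<le> \<theta>3"
      by (simp add: theta1)
    also have "\<theta>3 \<le> 0.07 * (1 - \<sigma>) * \<gamma>"
      unfolding theta3 by (rule Min_le) auto
    also have "\<dots> \<le> 0.9 * \<gamma> * (1 - \<sigma>)"
      using gamma(1) q(1) unfolding q_def[symmetric] by simp
    finally show "\<theta>1 \<le> 0.9 * \<gamma> * (1 - \<sigma>)" .
    show "\<theta>1 \<le> \<eta> / 2"
      using eps_nonneg eta(1) by (auto simp: theta1 theta2 min_def)
  qed
  note sum_bound = T.expectation_sum_bound[OF theta(2,3,1), folded U0]
  note step = T.expectation_step[OF T.integrable_Phi]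
  show ?thesis
    unfolding disagreement_stationarity gap
  proof (intro allI conjI impI)
    show "integrable M (\<lambda>\<omega>. T.disagreement t \<omega> + T.stationarity t \<omega>)" for t
      by (rule Bochner_Integration.integrable_add[OF step(1,2)])
    show "integrable M (\<lambda>\<omega>. T.gap k \<omega>)" for k
      by (rule step(3))
  qed (rule sum_bound T.expectation_gap[folded U0 V0] | assumption)+
qed

end
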